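(* Let $V$, $a(\cdot,\cdot)$, $f$, $g$, $u$, $z$, $V_{\mathrm{off}}$, the eigenvalues $\lambda^{(i)}_{l_i+1}$ and the constant $C_{err}$ be as defined in the context. Let $V_{ms}^0 = V_{\mathrm{off}}$, and for $k\ge 0$ let the spaces $V_{ms}^{k+1}$ be obtained from $V_{ms}^k$ by primal-dual online enrichment over index sets $I_p=I_p^k$, $I_d=I_d^k\subset\{1,\dots,N_c\}$, where the neighborhoods $\omega_i$, $i\in I_p^k$, are pairwise non-overlapping and the neighborhoods $\omega_j$, $j\in I_d^k$, are pairwise non-overlapping, i.e. $$V_{ms}^{k+1}=V_{ms}^k+\operatorname{span}\{\phi_i^k,\psi_j^k:\ i\in I_p^k,\ j\in I_d^k\}.$$ Let $u_{ms}^k,z_{ms}^k\in V_{ms}^k$ be the primal and dual multiscale solutions, and let $r_{i}=r_{i}^{k}$ and $r_{i}^{*}=r_{i}^{*,k}$ be the dual norms of the local primal and dual residuals at level $k$. Put $\Lambda_p^k=\min_{i\in I_p^k}\lambda^{(i)}_{l_i+1}$ and $\Lambda_d^k=\min_{j\in I_d^k}\lambda^{(j)}_{l_j+1}$. Let $m\ge 0$. Assume that the online error reduction property (ONERP) holds: there is a constant $\theta_0\in(0,1)$, with $\theta_0>\delta$ where $\delta$ is independent of the permeability field $\kappa$, such that for every level $k=0,1,\dots,m$ $$\frac{\Lambda_p^k}{C_{err}}\;\frac{\sum_{i\in I_p^k}(r_i^k)^2\,(\lambda^{(i)}_{l_i+1})^{-1}}{\sum_{i=1}^{N_c}(r_i^k)^2\,(\lambda^{(i)}_{l_i+1})^{-1}}\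 \ge\ \theta_0 \qquad\text{and}\qquad \frac{\Lambda_d^k}{C_{err}}\;\frac{\sum_{j\in I_d^k}(r_j^{*,k})^2\,(\lambda^{(j)}_{l_j+1})^{-1}}{\sum_{j=1}^{N_c}(r_j^{*,k})^2\,(\lambda^{(j)}_{l_j+1})^{-1}}\ \ge\ \theta_0 .$$ Then $$|g(u-u_{ms}^{m+1})|\ \le\ (1-\theta_0)\,\|u-u_{ms}^m\|_V\,\|z-z_{ms}^m\|_V\ \le\ (1-\theta_0)^{m+1}\,\|u-u_{ms}^0\|_V\,\|z-z_{ms}^0\|_V .$$
   Context: **Problem and grids.** $\Omega\subset\mathbb{R}^d$ ($d=2,3$) is the computational domain; $\kappa$ is a measurable function (the permeability field) with $\kappa_0\le\kappa(x)\le\kappa_1$ for a.e. $x\in\Omega$, with constants $0<\kappa_0\ll\kappa_1$; $f\in L^2(\Omega)$. Set $$a(v,w)=\int_\Omega\kappa\,\nabla v\cdot\nabla w\,dx,\qquad f(v)=\int_\Omega f v\,dx .$$ $\mathcal{T}^H$ is a conforming partition of $\Omega$ of mesh size $H$ (coarse grid) and $\mathcal{T}^h$ is a conforming refinement of it of mesh size $h\ll H$ (fine grid). $V\subset H_0^1(\Omega)$ is the conforming piecewise linear finite element space on $\mathcal{T}^h$, with energy norm $\|v\|_V=a(v,v)^{1/2}$. $x_1,\dots,x_{N_c}$ are the interior nodes of $\mathcal{T}^H$, and the coarse neighborhood $\omega_i$ is the union of all coarse elements having $x_i$ as a vertex. Neighborhoods are non-overlapping if their interiors are disjoint. Set $V_i=H_0^1(\omega_i)\cap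 V$ (functions extended by zero), with norm $\|v\|_{V_i}=a(v,v)^{1/2}$ and dual norm $\|R\|_{V_i^*}=\sup_{0\ne v\in V_i}|R(v)|/\|v\|_{V_i}$. **Primal and dual problems.** $g:V\to\mathbb{R}$ is a given linear functional (goal functional). The fine-scale primal and dual solutions $u,z\in V$ satisfy $a(u,v)=f(v)$ and $a(z,v)=g(v)$ for all $v\in V$. **Offline space.** All local functions below are understood as fine-grid (finite element) functions, so that $V_{\mathrm{off}}$ is a subspace of $V$. - Snapshots: for each $i$, let $L_i$ be the number of fine-grid nodes on $\partial\omega_i$. For $l=1,\dots,L_i$, $\eta^{(i)}_l$ solves $-\mathrm{div}(\kappa\nabla\eta^{(i)}_l)=0$ in $\omega_i$ with boundary value $\delta_l^h$ on $\partial\omega_i$, where $\delta^h_l$ is the fine-grid function equal to $1$ at the $l$-th boundary node and $0$ at the others. $V^{(i)}_{snap}=\operatorname{span}\{\eta^{(i)}_l:1\le l\le L_i\}$. - Partition of unity: $\{\chi_i\}_{i=1}^{N_c}$ are the standard multiscale finite element basis functions: $-\mathrm{div}(\kappa\nabla\chi_i)=0$ in each coarse element $K\subset\omega_i$, $\chi_i=p_i$ on $\partial K$ with $p_i$ linear and continuous on $\partial K$, and $\chi_i=0$ on $\partial\omega_i$. They are taken to be a partition of unity subordinate to the coarse neighborhoods. - Spectral problem: find $\phi^{(i)}_j\in V^{(i)}_{snap}$ and $\lambda^{(i)}_j\in\mathbb{R}$, $j=1,\dots,L_i$, with $$\int_{\omega_i}\kappa\nabla\phi^{(i)}_j\cdot\nabla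 w\,dx=\lambda^{(i)}_j\int_{\omega_i}\tilde\kappa\,\phi^{(i)}_j w\,dx\quad\forall w\in V^{(i)}_{snap},\qquad \tilde\kappa=H^2\sum_{j=1}^{N_c}\kappa|\nabla\chi_j|^2,$$ normalized by $\int_{\omega_i}\tilde\kappa(\phi_j^{(i)})^2dx=1$, eigenvalues in ascending order. The form $\int_{\omega_i}\tilde\kappa vw\,dx$ is taken to be positive definite on $V^{(i)}_{snap}$. - For chosen integers $l_i\ge1$ (so that $\lambda^{(i)}_{l_i+1}$ is defined and positive), $V^{(i)}_{\mathrm{off}}=\operatorname{span}\{\chi_i\phi^{(i)}_j:1\le j\le l_i\}$ and $V_{\mathrm{off}}=\sum_{i=1}^{N_c}V^{(i)}_{\mathrm{off}}\subset V$. Thus $\lambda^{(i)}_{l_i+1}$ is the smallest eigenvalue whose eigenvector is excluded on $\omega_i$. **Online enrichment at level $k$.** Given a space $V_{ms}^k$ with $V_{\mathrm{off}}\subset V_{ms}^k\subset V$, the functions $u_{ms}^k,z_{ms}^k\in V_{ms}^k$ satisfy $a(u_{ms}^k,v)=f(v)$ and $a(z_{ms}^k,v)=g(v)$ for all $v\in V_{ms}^k$. The local residuals are, for $v\in V_i$, $$R_i^{u,k}(v)=f(v)-a(u_{ms}^k,v),\qquad R_i^{z,k}(v)=g(v)-a(z_{ms}^k,v),$$ with $r_i^k=\|R_i^{u,k}\|_{V_i^*}$ and $r_i^{*,k}=\|R_i^{z,k}\|_{V_i^*}$. The online basis functions $\phi_i^k,\psi_i^k\in V_i$ are defined by $$a(\phi_i^k,v)=R_i^{u,k}(v),\qquad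 a(\psi_i^k,v)=R_i^{z,k}(v)\qquad\forall v\in V_i .$$ The index sets $I_p^k,I_d^k$ are nonempty, and the denominators in the ONERP quotients are understood to be nonzero. **The constant $C_{err}$.** $C_{err}>0$ is a uniform constant, independent of the contrast of $\kappa$, for which the following residual a posteriori error bound holds: for every linear functional $\ell$ on $V$ and every subspace $W$ with $V_{\mathrm{off}}\subset W\subset V$, if $y\in V$ and $y_W\in W$ satisfy $a(y,v)=\ell(v)$ for all $v\in V$ and $a(y_W,v)=\ell(v)$ for all $v\in W$, then $$\|y-y_W\|_V^2\le C_{err}\sum_{i=1}^{N_c}\big\|(\ell-a(y_W,\cdot))|_{V_i}\big\|_{V_i^*}^2\,\big(\lambda^{(i)}_{l_i+1}\big)^{-1}.$$ *)

theory Defs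
  imports "HOL-Analysis.Analysis" "HOL-Library.Function_Algebras"
begin

text \<open>Functions on the whole space form a real vector space; finite element functions on a
  subregion are represented by functions that are 0 outside it.\<close>

interpretation fn: vector_space "\<lambda>(c::real) (v::'a \<Rightarrow> real) x. c * v x"
  by unfold_locales (auto simp: fun_eq_iff algebra_simps)

subsection \<open>Gradients, forms and the space \<open>H\<^sub>0\<^sup>1\<close>\<close>

text \<open>For a piecewise affine function this is the piecewise constant weak gradient; the value at
  points of non-differentiability (a null set) is immaterial.\<close>

definition grad :: "('a::euclidean_space \<Rightarrow> real) \<Rightarrow> 'a \<Rightarrow> 'a" where
  "grad v x = (\<Sum>b\<in>Basis. frechet_derivative v (at x) b *\<^sub>R b)"

definition energy_form ::
    "('a::euclidean_space \<Rightarrow> real) \<Rightarrow> 'a set \<Rightarrow> ('a \<Rightarrow> real) \<Rightarrow> ('a \<Rightarrow> real) \<Rightarrow> real" where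
  "energy_form \<kappa> D v w = (LINT x|lebesgue_on D. \<kappa> x * (grad v x \<bullet> grad w x))"

definition mass_form ::
    "('a::euclidean_space \<Rightarrow> real) \<Rightarrow> 'a set \<Rightarrow> ('a \<Rightarrow> real) \<Rightarrow> ('a \<Rightarrow> real) \<Rightarrow> real" where
  "mass_form \<rho> D v w = (LINT x|lebesgue_on D. \<rho> x * v x * w x)"

coinductive smooth :: "('a::euclidean_space \<Rightarrow> real) \<Rightarrow> bool" where
  "\<lbrakk>\<forall>x. w differentiable (at x); \<forall>b\<in>Basis. smooth (\<lambda>x. grad w x \<bullet> b)\<rbrakk> \<Longrightarrow> smooth w"

text \<open>For open \<open>D\<close>: the closure of \<open>C\<^sub>c\<^sup>\<infinity>(D)\<close> in the Sobolev norm, extended by zero;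
  \<open>G\<close> is the weak gradient of \<open>v\<close>.\<close>

definition H10 :: "'a::euclidean_space set \<Rightarrow> ('a \<Rightarrow> real) set" where
  "H10 D = {v. v \<in> borel_measurable lebesgue \<and>
     (\<exists>G w. G \<in> borel_measurable lebesgue \<and>
        (\<forall>n::nat. smooth (w n) \<and> (\<exists>C. compact C \<and> C \<subseteq> D \<and> (\<forall>x. x \<notin> C \<longrightarrow> w n x = 0))) \<and>
        (\<lambda>n. \<integral>\<^sup>+x. ennreal ((v x - w n x)\<^sup>2) \<partial>lebesgue) \<longlonglongrightarrow> 0 \<and>
        (\<lambda>n. \<integral>\<^sup>+x. ennreal ((norm (G x - grad (w n) x))\<^sup>2) \<partial>lebesgue) \<longlonglongrightarrow> 0)}"

subsection \<open>Grids\<close>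

definition vertices :: "'a::euclidean_space set \<Rightarrow> 'a set" where
  "vertices K = {p. p extreme_point_of K}"

definition nodes :: "'a::euclidean_space set set \<Rightarrow> 'a set" where
  "nodes \<T> = (\<Union>K\<in>\<T>. vertices K)"

definition mesh_size :: "'a::euclidean_space set set \<Rightarrow> real" where
  "mesh_size \<T> = Max (diameter ` \<T>)"

definition conforming_partition :: "'a::euclidean_space set set \<Rightarrow> 'a set \<Rightarrow> bool" where
  "conforming_partition \<T> \<Omega> \<longleftrightarrow>
     finite \<T> \<and> (\<forall>K\<in>\<T>. polytope K \<and> interior K \<noteq> {}) \<and>
     (\<forall>K\<in>\<T>. \<forall>K'\<in>\<T>. (K \<inter> K') face_of K \<and> (K \<inter> K') face_of K') \<and>
     \<Union>\<T> = closure \<Omega> \<and> interior (\<Union>\<T>) = \<Omega>"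

definition simplicial_refinement ::
    "'a::euclidean_space set set \<Rightarrow> 'a set set \<Rightarrow> bool" where
  "simplicial_refinement \<T>h \<T>H \<longleftrightarrow>
     triangulation \<T>h \<and> (\<forall>T\<in>\<T>h. int DIM('a) simplex T) \<and>
     \<Union>\<T>h = \<Union>\<T>H \<and> (\<forall>T\<in>\<T>h. \<exists>K\<in>\<T>H. T \<subseteq> K)"

definition neighborhood :: "'a::euclidean_space set set \<Rightarrow> 'a \<Rightarrow> 'a set" where
  "neighborhood \<T>H p = \<Union>{K\<in>\<T>H. p \<in> vertices K}"

subsection \<open>Finite element spaces\<close>

definition affine_fun_on :: "'a::euclidean_space set \<Rightarrow> ('a \<Rightarrow> real) \<Rightarrow> bool" where
  "affine_fun_on S v \<longleftrightarrow> (\<exists>g c. \<forall>x\<in>S. v x = g \<bullet> x + c)"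

definition fe_space :: "'a::euclidean_space set set \<Rightarrow> 'a set \<Rightarrow> ('a \<Rightarrow> real) set" where
  "fe_space \<T>h \<Omega> = {v \<in> H10 \<Omega>. continuous_on UNIV v \<and> (\<forall>T\<in>\<T>h. affine_fun_on T v)}"

text \<open>\<open>H\<^sub>0\<^sup>1(\<omega>) \<inter> V\<close> for a closed region \<open>\<omega>\<close>.\<close>

definition local_space :: "('a::euclidean_space \<Rightarrow> real) set \<Rightarrow> 'a set \<Rightarrow> ('a \<Rightarrow> real) set" where
  "local_space V \<omega> = V \<inter> H10 (interior \<omega>)"

text \<open>Finite element functions on a closed region \<open>\<omega>\<close>, without boundary condition on the frontier
  of \<open>\<omega>\<close>.\<close>

definition fe_functions :: "'a::euclidean_space set set \<Rightarrow> 'a set \<Rightarrow> ('a \<Rightarrow> real) set" where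
  "fe_functions \<T>h \<omega> = {v. continuous_on \<omega> v \<and>
     (\<forall>T\<in>\<T>h. T \<subseteq> \<omega> \<longrightarrow> affine_fun_on T v) \<and> (\<forall>x. x \<notin> \<omega> \<longrightarrow> v x = 0)}"

subsection \<open>Functionals and Galerkin problems\<close>

definition linear_functional_on ::
    "('a \<Rightarrow> real) set \<Rightarrow> (('a \<Rightarrow> real) \<Rightarrow> real) \<Rightarrow> bool" where
  "linear_functional_on V lf \<longleftrightarrow>
     (\<forall>v\<in>V. \<forall>w\<in>V. lf (v + w) = lf v + lf w) \<and> (\<forall>c. \<forall>v\<in>V. lf (\<lambda>x. c * v x) = c * lf v)"

definition energy_norm ::
    "(('a \<Rightarrow> real) \<Rightarrow> ('a \<Rightarrow> real) \<Rightarrow> real) \<Rightarrow> ('a \<Rightarrow> real) \<Rightarrow> real" where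
  "energy_norm a v = sqrt (a v v)"

text \<open>The inserted 0 only fixes the value on the trivial space.\<close>

definition dual_norm ::
    "(('a \<Rightarrow> real) \<Rightarrow> ('a \<Rightarrow> real) \<Rightarrow> real) \<Rightarrow> ('a \<Rightarrow> real) set \<Rightarrow>
     (('a \<Rightarrow> real) \<Rightarrow> real) \<Rightarrow> real" where
  "dual_norm a W R = Sup (insert 0 {\<bar>R v\<bar> / energy_norm a v | v. v \<in> W \<and> v \<noteq> 0})"

definition galerkin_solution ::
    "(('a \<Rightarrow> real) \<Rightarrow> ('a \<Rightarrow> real) \<Rightarrow> real) \<Rightarrow> ('a \<Rightarrow> real) set \<Rightarrow>
     (('a \<Rightarrow> real) \<Rightarrow> real) \<Rightarrow> ('a \<Rightarrow> real) \<Rightarrow> bool" where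
  "galerkin_solution a W lf y \<longleftrightarrow> y \<in> W \<and> (\<forall>v\<in>W. a y v = lf v)"

subsection \<open>The offline space\<close>

definition boundary_nodes :: "'a::euclidean_space set set \<Rightarrow> 'a set \<Rightarrow> 'a set" where
  "boundary_nodes \<T>h \<omega> = nodes \<T>h \<inter> frontier \<omega>"

text \<open>The snapshot \<open>\<eta>\<close> on \<open>\<omega>\<close> attached to the boundary node \<open>p\<close>. A finite element function is
  determined on the frontier of \<open>\<omega>\<close> by its values at the fine nodes there, so the nodal conditions
  say that its trace is the discrete delta function at \<open>p\<close>.\<close>

definition is_snapshot ::
    "'a::euclidean_space set set \<Rightarrow> ('a \<Rightarrow> real) set \<Rightarrow> ('a \<Rightarrow> real) \<Rightarrow> 'a set \<Rightarrow> 'a \<Rightarrow>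
     ('a \<Rightarrow> real) \<Rightarrow> bool" where
  "is_snapshot \<T>h V \<kappa> \<omega> p \<eta> \<longleftrightarrow>
     \<eta> \<in> fe_functions \<T>h \<omega> \<and>
     (\<forall>q\<in>boundary_nodes \<T>h \<omega>. \<eta> q = (if q = p then 1 else 0)) \<and>
     (\<forall>v\<in>local_space V \<omega>. energy_form \<kappa> \<omega> \<eta> v = 0)"

text \<open>The multiscale basis function of the coarse node \<open>p\<close>. On the boundary of a coarse element it
  equals the coarse nodal function that is affine on each facet.\<close>

definition is_ms_basis ::
    "'a::euclidean_space set set \<Rightarrow> ('a \<Rightarrow> real) set \<Rightarrow> ('a \<Rightarrow> real) \<Rightarrow> 'a \<Rightarrow>
     ('a \<Rightarrow> real) \<Rightarrow> bool" where
  "is_ms_basis \<T>H V \<kappa> p chi \<longleftrightarrow>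
     chi \<in> local_space V (neighborhood \<T>H p) \<and>
     (\<forall>q\<in>nodes \<T>H. chi q = (if q = p then 1 else 0)) \<and>
     (\<forall>K\<in>\<T>H. p \<in> vertices K \<longrightarrow>
        (\<forall>F. F facet_of K \<longrightarrow> affine_fun_on F chi) \<and>
        (\<forall>v\<in>local_space V K. energy_form \<kappa> K chi v = 0))"

text \<open>The index set runs over interior coarse nodes only and every \<open>chi i\<close> vanishes on the boundary
  of the domain, so the functions can sum to 1 only on coarse elements none of whose vertices lies
  on that boundary.\<close>

definition ms_partition_of_unity ::
    "'a::euclidean_space set set \<Rightarrow> 'a set \<Rightarrow> ('a \<Rightarrow> real) set \<Rightarrow> ('a \<Rightarrow> real) \<Rightarrow> nat \<Rightarrow>
     (nat \<Rightarrow> 'a) \<Rightarrow> (nat \<Rightarrow> 'a \<Rightarrow> real) \<Rightarrow> bool" where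
  "ms_partition_of_unity \<T>H \<Omega> V \<kappa> Nc nd chi \<longleftrightarrow>
     (\<forall>i\<in>{1..Nc}. is_ms_basis \<T>H V \<kappa> (nd i) (chi i)) \<and>
     (\<forall>K\<in>\<T>H. vertices K \<subseteq> \<Omega> \<longrightarrow> (\<forall>x\<in>K. (\<Sum>i=1..Nc. chi i x) = 1))"

definition kappa_tilde ::
    "('a::euclidean_space \<Rightarrow> real) \<Rightarrow> real \<Rightarrow> nat \<Rightarrow> (nat \<Rightarrow> 'a \<Rightarrow> real) \<Rightarrow> 'a \<Rightarrow> real" where
  "kappa_tilde \<kappa> H Nc chi x = H\<^sup>2 * (\<Sum>j=1..Nc. \<kappa> x * (norm (grad (chi j) x))\<^sup>2)"

text \<open>A complete system of \<open>L\<close> normalized eigenpairs on the snapshot space \<open>S\<close>; the spanning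
  condition makes every eigenvalue appear with its multiplicity (the space has dimension \<open>L\<close>).\<close>

definition spectral_system ::
    "('a::euclidean_space \<Rightarrow> real) \<Rightarrow> ('a \<Rightarrow> real) \<Rightarrow> 'a set \<Rightarrow> ('a \<Rightarrow> real) set \<Rightarrow> nat \<Rightarrow>
     (nat \<Rightarrow> 'a \<Rightarrow> real) \<Rightarrow> (nat \<Rightarrow> real) \<Rightarrow> bool" where
  "spectral_system \<kappa> \<kappa>t \<omega> S L \<phi> lam \<longleftrightarrow>
     (\<forall>j\<in>{1..L}. \<phi> j \<in> S \<and>
        (\<forall>w\<in>S. energy_form \<kappa> \<omega> (\<phi> j) w = lam j * mass_form \<kappa>t \<omega> (\<phi> j) w) \<and>
        mass_form \<kappa>t \<omega> (\<phi> j) (\<phi> j) = 1) \<and>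
     fn.span (\<phi> ` {1..L}) = S \<and>
     mono_on {1..L} lam"

text \<open>Products of a partition of unity function and an eigenfunction are not piecewise affine; they
  are read as the finite element function in \<open>V\<close> with the same values at the fine nodes.\<close>

definition local_offline_space ::
    "'a::euclidean_space set set \<Rightarrow> ('a \<Rightarrow> real) set \<Rightarrow> ('a \<Rightarrow> real) \<Rightarrow> (nat \<Rightarrow> 'a \<Rightarrow> real) \<Rightarrow> nat \<Rightarrow>
     ('a \<Rightarrow> real) set" where
  "local_offline_space \<T>h V chi \<phi> l =
     fn.span {w\<in>V. \<exists>j\<in>{1..l}. \<forall>p\<in>nodes \<T>h. w p = chi p * \<phi> j p}"

subsection \<open>A posteriori bound\<close>

definition a_posteriori_bound ::
    "(('a \<Rightarrow> real) \<Rightarrow> ('a \<Rightarrow> real) \<Rightarrow> real) \<Rightarrow> ('a \<Rightarrow> real) set \<Rightarrow> ('a \<Rightarrow> real) set \<Rightarrow> nat \<Rightarrow>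
     (nat \<Rightarrow> ('a \<Rightarrow> real) set) \<Rightarrow> (nat \<Rightarrow> real) \<Rightarrow> real \<Rightarrow> bool" where
  "a_posteriori_bound a V Voff Nc Vloc lam_ex C \<longleftrightarrow>
     (\<forall>lf W y yW. linear_functional_on V lf \<and> fn.subspace W \<and> Voff \<subseteq> W \<and> W \<subseteq> V \<and>
        galerkin_solution a V lf y \<and> galerkin_solution a W lf yW \<longrightarrow>
        (energy_norm a (y - yW))\<^sup>2 \<le>
          C * (\<Sum>i=1..Nc. (dual_norm a (Vloc i) (\<lambda>v. lf v - a yW v))\<^sup>2 * inverse (lam_ex i)))"

end

theory Submission
  imports Defs
begin

text \<open>Functions in the local spaces of non-overlapping neighborhoods are orthogonal for the energy
  form, so enriching the Galerkin space by the local Riesz representatives of the residuals lowers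
  the squared energy error by at least the sum of the squared local residual norms. The a posteriori
  bound and the ONERP turn this sum into the fraction \<open>\<theta>0\<close> of the squared error; hence every
  enrichment contracts both the primal and the dual squared error by \<open>1 - \<theta>0\<close>. By Galerkin
  orthogonality \<open>g (u - ums k) = a (z - zms k) (u - ums k)\<close>, and Cauchy--Schwarz bounds the
  goal error by the product of the two.\<close>

subsection \<open>Gradients and \<open>H\<^sub>0\<^sup>1\<close>\<close>

text \<open>The space \<open>V\<close> rests on raw definitions: a closure of test functions for the
  boundary condition, and a pointwise \<open>grad\<close> whose value is unspecified wherever a
  function is not differentiable. Hence even the linearity of \<open>a\<close> in one argument, and
  the orthogonality across neighborhoods, have to be derived. Both come from computing cell by cell:
  off the cell frontiers, a null set, every finite element function is locally affine and
  \<open>grad\<close> is its true, locally constant gradient. The shape of the ONERP reflects a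
  mismatch of weights. The gain of an enrichment is a plain sum of squared residual norms over the
  selected neighborhoods, while the a posteriori bound weights all of them by inverse eigenvalues.
  The minima \<open>\<Lambda>p\<close> and \<open>\<Lambda>d\<close> convert one weighting into the
  other, and \<open>C_err\<close> cancels. Each error norm alone contracts by the square root of
  \<open>1 - \<theta>0\<close>; only the product in the goal error recovers the full factor per
  level.\<close>

lemma has_derivative_grad:
  assumes "v differentiable (at x)"
  shows "(v has_derivative (\<lambda>h. grad v x \<bullet> h)) (at x)"
proof -
  let ?D = "frechet_derivative v (at x)"
  have D: "(v has_derivative ?D) (at x)"
    using assms by (simp add: frechet_derivative_works)
  then have lin: "linear ?D" by (rule has_derivative_linear)
  have "?D h = grad v x \<bullet> h" for h
  proof -
    have "?D h = ?D (\<Sum>b\<in>Basis. (h \<bullet> b) *\<^sub>R b)" by (simp add: euclidean_representation)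
    also have "\<dots> = (\<Sum>b\<in>Basis. (h \<bullet> b) * ?D b)"
      by (simp add: linear_sum[OF lin] linear_scale[OF lin])
    also have "\<dots> = grad v x \<bullet> h"
      by (simp add: grad_def inner_sum_left inner_commute[of h] mult.commute)
    finally show ?thesis .
  qed
  then have "?D = (\<lambda>h. grad v x \<bullet> h)" by (rule ext)
  then show ?thesis using D by simp
qed

text \<open>Gradients are computed through this rule: exhibit a derivative in inner product form,
  and uniqueness of the Frechet derivative does the rest.\<close>

lemma grad_unique:
  assumes "(v has_derivative (\<lambda>h. p \<bullet> h)) (at x)"
  shows "grad v x = p"
proof -
  have "frechet_derivative v (at x) = (\<lambda>h. p \<bullet> h)"
    using frechet_derivative_at[OF assms] by simp
  then show ?thesis by (simp add: grad_def euclidean_representation)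
qed

lemma grad_add:
  assumes "v differentiable (at x)" "w differentiable (at x)"
  shows "grad (v + w) x = grad v x + grad w x"
proof (rule grad_unique)
  show "(v + w has_derivative (\<lambda>h. (grad v x + grad w x) \<bullet> h)) (at x)"
    using has_derivative_add[OF assms[THEN has_derivative_grad]]
    by (simp add: plus_fun_def inner_add_left)
qed

lemma grad_scale:
  assumes "v differentiable (at x)"
  shows "grad (\<lambda>x. c * v x) x = c *\<^sub>R grad v x"
proof (rule grad_unique)
  show "((\<lambda>x. c * v x) has_derivative (\<lambda>h. (c *\<^sub>R grad v x) \<bullet> h)) (at x)"
    using has_derivative_mult_right[OF has_derivative_grad[OF assms], of c] by simp
qed

text \<open>Differentiation is local, so agreement with an affine function near the point suffices.
  \<open>T\<close> is an arbitrary set, which later allows a cell, its interior, or a smaller open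
  set inside it.\<close>

lemma grad_affine:
  assumes "x \<in> interior T" "\<And>y. y \<in> T \<Longrightarrow> v y = p \<bullet> y + c"
  shows "v differentiable (at x)" and "grad v x = p"
proof -
  have "((\<lambda>y. p \<bullet> y + c) has_derivative (\<lambda>h. p \<bullet> h)) (at x)"
    by (auto intro!: derivative_eq_intros)
  then have *: "(v has_derivative (\<lambda>h. p \<bullet> h)) (at x)"
    by (rule has_derivative_transform_within_open[OF _ open_interior assms(1)])
      (use assms(2) interior_subset in fastforce)
  show "v differentiable (at x)" using * by (rule differentiableI)
  show "grad v x = p" using * by (rule grad_unique)
qed

section \<open>The vector space of smooth functions\<close>

lemma smooth_differentiable: "smooth w \<Longrightarrow> w differentiable (at x)"
  by (erule smooth.cases) simp

lemma smooth_partial: "\<lbrakk>smooth w; b \<in> Basis\<rbrakk> \<Longrightarrow> smooth (\<lambda>x. grad w x \<bullet> b)"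
  by (erule smooth.cases) (hypsubst, erule bspec)

lemma smooth_continuous: "smooth w \<Longrightarrow> continuous_on UNIV w"
  by (simp add: smooth_differentiable differentiable_imp_continuous_within
      continuous_on_eq_continuous_within)

lemma smooth_zero: "smooth (\<lambda>_. 0)"
proof -
  have g0: "grad (\<lambda>_::'a. 0) x = 0" for x :: 'a
    by (rule grad_unique) simp
  have "v = (\<lambda>_. 0) \<Longrightarrow> smooth v" for v :: "'a \<Rightarrow> real"
  proof (coinduction arbitrary: v rule: smooth.coinduct)
    case smooth
    then show ?case using g0 by auto
  qed
  then show ?thesis by simp
qed

text \<open>By coinduction with the set of all sums of two smooth functions as candidate: partial
  derivatives of such a sum are again such sums.\<close>

lemma smooth_add:
  assumes "smooth v" "smooth w"
  shows "smooth (v + w)"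
proof -
  have "\<exists>v w. u = v + w \<and> smooth v \<and> smooth w \<Longrightarrow> smooth u" for u :: "'a \<Rightarrow> real"
  proof (coinduction arbitrary: u rule: smooth.coinduct)
    case smooth
    then obtain v w where u: "u = v + w" and vw: "smooth v" "smooth w" by blast
    note d = vw[THEN smooth_differentiable]
    have "u differentiable (at x)" for x
      using differentiable_add[OF d, of x] by (simp add: u plus_fun_def)
    moreover have "(\<lambda>x. grad u x \<bullet> b) = (\<lambda>x. grad v x \<bullet> b) + (\<lambda>x. grad w x \<bullet> b)" for b
      by (simp add: u grad_add d fun_eq_iff inner_add_left)
    ultimately show ?case using vw smooth_partial by blast
  qed
  then show ?thesis using assms by blast
qed

lemma smooth_scale:
  assumes "smooth v"
  shows "smooth (\<lambda>x. c * v x)"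
proof -
  have *: "\<exists>v. u = (\<lambda>x. c * v x) \<and> smooth v \<Longrightarrow> smooth u" for u :: "'a \<Rightarrow> real"
  proof (coinduction arbitrary: u rule: smooth.coinduct)
    case smooth
    then obtain v where u: "u = (\<lambda>x. c * v x)" and v: "smooth v" by blast
    note d = v[THEN smooth_differentiable]
    have "u differentiable (at x)" for x
      unfolding u using d by (intro differentiable_mult) simp_all
    moreover have "(\<exists>v. (\<lambda>x. grad u x \<bullet> b) = (\<lambda>x. c * v x) \<and> smooth v) \<or>
        smooth (\<lambda>x. grad u x \<bullet> b)" if "b \<in> Basis" for b
      by (intro disjI1 exI[of _ "\<lambda>x. grad v x \<bullet> b"] conjI smooth_partial[OF v that])
        (simp add: u grad_scale d)
    ultimately show ?case by simp
  qed
  show ?thesis by (rule *) (intro exI[of _ v] conjI refl assms)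
qed

section \<open>Measurability and mean-square convergence\<close>

lemma continuous_borel_measurable_lebesgue:
  "continuous_on UNIV (v :: 'a::euclidean_space \<Rightarrow> 'b::euclidean_space) \<Longrightarrow> v \<in> borel_measurable lebesgue"
  by (intro measurable_completion) (simp add: borel_measurable_continuous_onI)

text \<open>The partial derivatives of a smooth function are smooth themselves, hence continuous,
  and the gradient is assembled from finitely many of them.\<close>

lemma smooth_grad_measurable:
  assumes "smooth w"
  shows "grad w \<in> borel_measurable lebesgue"
proof -
  have "continuous_on UNIV (\<lambda>x. \<Sum>b\<in>Basis. (grad w x \<bullet> b) *\<^sub>R b)"
    using assms by (intro continuous_intros smooth_continuous smooth_partial)
  then have "continuous_on UNIV (grad w)" by (simp add: euclidean_representation)
  then show ?thesis by (rule continuous_borel_measurable_lebesgue)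
qed

lemma nn_integral_square_add_tendsto_0:
  fixes p q :: "nat \<Rightarrow> 'a \<Rightarrow> 'b::euclidean_space"
  assumes [measurable]: "\<And>n. p n \<in> borel_measurable M" "\<And>n. q n \<in> borel_measurable M"
    and p: "(\<lambda>n. \<integral>\<^sup>+x. ennreal ((norm (p n x))\<^sup>2) \<partial>M) \<longlonglongrightarrow> 0"
    and q: "(\<lambda>n. \<integral>\<^sup>+x. ennreal ((norm (q n x))\<^sup>2) \<partial>M) \<longlonglongrightarrow> 0"
  shows "(\<lambda>n. \<integral>\<^sup>+x. ennreal ((norm (p n x + q n x))\<^sup>2) \<partial>M) \<longlonglongrightarrow> 0"
proof (rule tendsto_sandwich[where f = "\<lambda>_. 0"])
  show "(\<lambda>n. 2 * (\<integral>\<^sup>+x. ennreal ((norm (p n x))\<^sup>2) \<partial>M) +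
      2 * (\<integral>\<^sup>+x. ennreal ((norm (q n x))\<^sup>2) \<partial>M)) \<longlonglongrightarrow> 0"
    using tendsto_add[OF ennreal_tendsto_cmult[OF _ p] ennreal_tendsto_cmult[OF _ q], of 2 2]
    by simp
  have pt: "(norm (a + b))\<^sup>2 \<le> 2 * (norm a)\<^sup>2 + 2 * (norm b)\<^sup>2" for a b :: 'b
  proof -
    have "(norm (a + b))\<^sup>2 \<le> (norm a + norm b)\<^sup>2"
      by (intro power_mono norm_triangle_ineq norm_ge_zero)
    also have "\<dots> \<le> 2 * (norm a)\<^sup>2 + 2 * (norm b)\<^sup>2"
      using sum_squares_bound[of "norm a" "norm b"] by (simp add: power2_sum)
    finally show ?thesis .
  qed
  show "\<forall>\<^sub>F n in sequentially. (\<integral>\<^sup>+x. ennreal ((norm (p n x + q n x))\<^sup>2) \<partial>M) \<le>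
      2 * (\<integral>\<^sup>+x. ennreal ((norm (p n x))\<^sup>2) \<partial>M) + 2 * (\<integral>\<^sup>+x. ennreal ((norm (q n x))\<^sup>2) \<partial>M)"
  proof (rule always_eventually, rule allI)
    fix n
    have "(\<integral>\<^sup>+x. ennreal ((norm (p n x + q n x))\<^sup>2) \<partial>M) \<le>
        (\<integral>\<^sup>+x. 2 * ennreal ((norm (p n x))\<^sup>2) + 2 * ennreal ((norm (q n x))\<^sup>2) \<partial>M)"
    proof (rule nn_integral_mono)
      fix x
      have "ennreal ((norm (p n x + q n x))\<^sup>2) \<le>
          ennreal (2 * (norm (p n x))\<^sup>2 + 2 * (norm (q n x))\<^sup>2)"
        by (rule ennreal_leI) (rule pt)
      then show "ennreal ((norm (p n x + q n x))\<^sup>2) \<le>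
          2 * ennreal ((norm (p n x))\<^sup>2) + 2 * ennreal ((norm (q n x))\<^sup>2)"
        by (simp add: ennreal_plus ennreal_mult)
    qed
    also have "\<dots> = 2 * (\<integral>\<^sup>+x. ennreal ((norm (p n x))\<^sup>2) \<partial>M) +
        2 * (\<integral>\<^sup>+x. ennreal ((norm (q n x))\<^sup>2) \<partial>M)"
      by (simp add: nn_integral_add nn_integral_cmult)
    finally show "(\<integral>\<^sup>+x. ennreal ((norm (p n x + q n x))\<^sup>2) \<partial>M) \<le> \<dots>" .
  qed
qed simp_all

lemma nn_integral_square_scale_tendsto_0:
  fixes p :: "nat \<Rightarrow> 'a \<Rightarrow> 'b::euclidean_space"
  assumes [measurable]: "\<And>n. p n \<in> borel_measurable M"
    and p: "(\<lambda>n. \<integral>\<^sup>+x. ennreal ((norm (p n x))\<^sup>2) \<partial>M) \<longlonglongrightarrow> 0"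
  shows "(\<lambda>n. \<integral>\<^sup>+x. ennreal ((norm (c *\<^sub>R p n x))\<^sup>2) \<partial>M) \<longlonglongrightarrow> 0"
  using ennreal_tendsto_cmult[OF _ p, of "ennreal (c\<^sup>2)"]
  by (simp add: power_mult_distrib ennreal_mult nn_integral_cmult)

text \<open>The definition squares real differences directly. Writing them with \<open>norm\<close>,
  as for the gradients, turns both convergence conditions into instances of the same lemmas on
  squared norms.\<close>

lemma H10_I:
  assumes "v \<in> borel_measurable lebesgue" "G \<in> borel_measurable lebesgue"
    "\<And>n. smooth (w n)" "\<And>n. \<exists>C. compact C \<and> C \<subseteq> D \<and> (\<forall>x. x \<notin> C \<longrightarrow> w n x = 0)"
    "(\<lambda>n. \<integral>\<^sup>+x. ennreal ((norm (v x - w n x))\<^sup>2) \<partial>lebesgue) \<longlonglongrightarrow> 0"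
    "(\<lambda>n. \<integral>\<^sup>+x. ennreal ((norm (G x - grad (w n) x))\<^sup>2) \<partial>lebesgue) \<longlonglongrightarrow> 0"
  shows "v \<in> H10 D"
  unfolding H10_def mem_Collect_eq
  by (intro conjI exI[of _ G] exI[of _ w] allI) (use assms in simp_all)

lemma H10_E:
  assumes "v \<in> H10 D"
  obtains G w where "v \<in> borel_measurable lebesgue" "G \<in> borel_measurable lebesgue"
    "\<forall>n::nat. smooth (w n) \<and> (\<exists>C. compact C \<and> C \<subseteq> D \<and> (\<forall>x. x \<notin> C \<longrightarrow> w n x = 0))"
    "(\<lambda>n. \<integral>\<^sup>+x. ennreal ((norm (v x - w n x))\<^sup>2) \<partial>lebesgue) \<longlonglongrightarrow> 0"
    "(\<lambda>n. \<integral>\<^sup>+x. ennreal ((norm (G x - grad (w n) x))\<^sup>2) \<partial>lebesgue) \<longlonglongrightarrow> 0"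
proof -
  from assms obtain G w where "v \<in> borel_measurable lebesgue" "G \<in> borel_measurable lebesgue"
    "\<forall>n::nat. smooth (w n) \<and> (\<exists>C. compact C \<and> C \<subseteq> D \<and> (\<forall>x. x \<notin> C \<longrightarrow> w n x = 0))"
    "(\<lambda>n. \<integral>\<^sup>+x. ennreal ((v x - w n x)\<^sup>2) \<partial>lebesgue) \<longlonglongrightarrow> 0"
    "(\<lambda>n. \<integral>\<^sup>+x. ennreal ((norm (G x - grad (w n) x))\<^sup>2) \<partial>lebesgue) \<longlonglongrightarrow> 0"
    unfolding H10_def mem_Collect_eq by blast
  then show ?thesis by (intro that[of G w]) simp_all
qed

lemma smooth_measurable: "smooth w \<Longrightarrow> w \<in> borel_measurable lebesgue"
  by (intro continuous_borel_measurable_lebesgue smooth_continuous)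

lemma H10_add:
  assumes "v1 \<in> H10 D" "v2 \<in> H10 D"
  shows "v1 + v2 \<in> H10 D"
proof -
  from assms(1) obtain G1 w1 where 1: "v1 \<in> borel_measurable lebesgue" "G1 \<in> borel_measurable lebesgue"
    "\<forall>n::nat. smooth (w1 n) \<and> (\<exists>C. compact C \<and> C \<subseteq> D \<and> (\<forall>x. x \<notin> C \<longrightarrow> w1 n x = 0))"
    "(\<lambda>n. \<integral>\<^sup>+x. ennreal ((norm (v1 x - w1 n x))\<^sup>2) \<partial>lebesgue) \<longlonglongrightarrow> 0"
    "(\<lambda>n. \<integral>\<^sup>+x. ennreal ((norm (G1 x - grad (w1 n) x))\<^sup>2) \<partial>lebesgue) \<longlonglongrightarrow> 0"
    by (rule H10_E)
  from assms(2) obtain G2 w2 where 2: "v2 \<in> borel_measurable lebesgue" "G2 \<in> borel_measurable lebesgue"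
    "\<forall>n::nat. smooth (w2 n) \<and> (\<exists>C. compact C \<and> C \<subseteq> D \<and> (\<forall>x. x \<notin> C \<longrightarrow> w2 n x = 0))"
    "(\<lambda>n. \<integral>\<^sup>+x. ennreal ((norm (v2 x - w2 n x))\<^sup>2) \<partial>lebesgue) \<longlonglongrightarrow> 0"
    "(\<lambda>n. \<integral>\<^sup>+x. ennreal ((norm (G2 x - grad (w2 n) x))\<^sup>2) \<partial>lebesgue) \<longlonglongrightarrow> 0"
    by (rule H10_E)
  have s1: "smooth (w1 n)" and c1: "\<exists>C. compact C \<and> C \<subseteq> D \<and> (\<forall>x. x \<notin> C \<longrightarrow> w1 n x = 0)" for n
    using 1(3) by auto
  have s2: "smooth (w2 n)" and c2: "\<exists>C. compact C \<and> C \<subseteq> D \<and> (\<forall>x. x \<notin> C \<longrightarrow> w2 n x = 0)" for n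
    using 2(3) by auto
  note [measurable] = 1(1,2) 2(1,2) smooth_measurable[OF s1] smooth_measurable[OF s2]
    smooth_grad_measurable[OF s1] smooth_grad_measurable[OF s2]
  show ?thesis
  proof (rule H10_I[where G = "\<lambda>x. G1 x + G2 x" and w = "\<lambda>n. w1 n + w2 n"])
    show "v1 + v2 \<in> borel_measurable lebesgue" unfolding plus_fun_def by measurable
    show "(\<lambda>x. G1 x + G2 x) \<in> borel_measurable lebesgue" by measurable
    show "smooth (w1 n + w2 n)" for n by (intro smooth_add s1 s2)
    show "\<exists>C. compact C \<and> C \<subseteq> D \<and> (\<forall>x. x \<notin> C \<longrightarrow> (w1 n + w2 n) x = 0)" for n
    proof -
      obtain C1 C2 where "compact C1" "C1 \<subseteq> D" "\<forall>x. x \<notin> C1 \<longrightarrow> w1 n x = 0"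
        "compact C2" "C2 \<subseteq> D" "\<forall>x. x \<notin> C2 \<longrightarrow> w2 n x = 0" using c1[of n] c2[of n] by blast
      then show ?thesis by (intro exI[of _ "C1 \<union> C2"]) auto
    qed
    have "(\<lambda>n. \<integral>\<^sup>+x. ennreal ((norm ((v1 x - w1 n x) + (v2 x - w2 n x)))\<^sup>2) \<partial>lebesgue) \<longlonglongrightarrow> 0"
      by (rule nn_integral_square_add_tendsto_0[OF _ _ 1(4) 2(4)]) measurable
    then show "(\<lambda>n. \<integral>\<^sup>+x. ennreal ((norm ((v1 + v2) x - (w1 n + w2 n) x))\<^sup>2) \<partial>lebesgue) \<longlonglongrightarrow> 0"
      by (simp add: algebra_simps)
    have "(\<lambda>n. \<integral>\<^sup>+x. ennreal ((norm ((G1 x - grad (w1 n) x) + (G2 x - grad (w2 n) x)))\<^sup>2) \<partial>lebesgue) \<longlonglongrightarrow> 0"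
      by (rule nn_integral_square_add_tendsto_0[OF _ _ 1(5) 2(5)]) measurable
    then show "(\<lambda>n. \<integral>\<^sup>+x. ennreal ((norm (G1 x + G2 x - grad (w1 n + w2 n) x))\<^sup>2) \<partial>lebesgue) \<longlonglongrightarrow> 0"
      by (simp add: grad_add smooth_differentiable s1 s2 algebra_simps)
  qed
qed

lemma H10_scale:
  assumes "v \<in> H10 D"
  shows "(\<lambda>x. c * v x) \<in> H10 D"
proof -
  from assms obtain G w where 1: "v \<in> borel_measurable lebesgue" "G \<in> borel_measurable lebesgue"
    "\<forall>n::nat. smooth (w n) \<and> (\<exists>C. compact C \<and> C \<subseteq> D \<and> (\<forall>x. x \<notin> C \<longrightarrow> w n x = 0))"
    "(\<lambda>n. \<integral>\<^sup>+x. ennreal ((norm (v x - w n x))\<^sup>2) \<partial>lebesgue) \<longlonglongrightarrow> 0"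
    "(\<lambda>n. \<integral>\<^sup>+x. ennreal ((norm (G x - grad (w n) x))\<^sup>2) \<partial>lebesgue) \<longlonglongrightarrow> 0"
    by (rule H10_E)
  have s1: "smooth (w n)" and c1: "\<exists>C. compact C \<and> C \<subseteq> D \<and> (\<forall>x. x \<notin> C \<longrightarrow> w n x = 0)" for n
    using 1(3) by auto
  note [measurable] = 1(1,2) smooth_measurable[OF s1] smooth_grad_measurable[OF s1]
  show ?thesis
  proof (rule H10_I[where G = "\<lambda>x. c *\<^sub>R G x" and w = "\<lambda>n x. c * w n x"])
    show "smooth (\<lambda>x. c * w n x)" for n by (intro smooth_scale s1)
    show "\<exists>C. compact C \<and> C \<subseteq> D \<and> (\<forall>x. x \<notin> C \<longrightarrow> c * w n x = 0)" for n
      using c1[of n] by auto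
    have "(\<lambda>n. \<integral>\<^sup>+x. ennreal ((norm (c *\<^sub>R (v x - w n x)))\<^sup>2) \<partial>lebesgue) \<longlonglongrightarrow> 0"
      by (rule nn_integral_square_scale_tendsto_0[OF _ 1(4)]) measurable
    then show "(\<lambda>n. \<integral>\<^sup>+x. ennreal ((norm (c * v x - c * w n x))\<^sup>2) \<partial>lebesgue) \<longlonglongrightarrow> 0"
      by (simp add: right_diff_distrib)
    have "(\<lambda>n. \<integral>\<^sup>+x. ennreal ((norm (c *\<^sub>R (G x - grad (w n) x)))\<^sup>2) \<partial>lebesgue) \<longlonglongrightarrow> 0"
      by (rule nn_integral_square_scale_tendsto_0[OF _ 1(5)]) measurable
    then show "(\<lambda>n. \<integral>\<^sup>+x. ennreal ((norm (c *\<^sub>R G x - grad (\<lambda>x. c * w n x) x))\<^sup>2) \<partial>lebesgue) \<longlonglongrightarrow> 0"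
      by (simp add: grad_scale smooth_differentiable s1 scaleR_right_diff_distrib)
  qed measurable
qed

lemma H10_zero: "0 \<in> H10 D"
proof (rule H10_I[where G = "\<lambda>_. 0" and w = "\<lambda>_ _. 0"])
  have "grad (\<lambda>_::'a. 0) x = 0" for x :: 'a
    by (rule grad_unique) simp
  then show "(\<lambda>n. \<integral>\<^sup>+x. ennreal ((norm ((0::'a) - grad (\<lambda>_::'a. 0) x))\<^sup>2) \<partial>lebesgue) \<longlonglongrightarrow> 0"
    by simp
qed (auto simp: smooth_zero zero_fun_def)

text \<open>The approximating test functions vanish off \<open>D\<close>, so the integral of the
  square of \<open>v\<close> over the complement of \<open>D\<close> is bounded by every
  approximation error, and these tend to 0. The orthogonality across neighborhoods rests on this
  fact.\<close>

lemma H10_vanishes_outside: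
  assumes v: "v \<in> H10 D" and D: "open D"
  shows "AE x in lebesgue. x \<notin> D \<longrightarrow> v x = 0"
proof -
  from v obtain G w where 1: "v \<in> borel_measurable lebesgue" "G \<in> borel_measurable lebesgue"
    "\<forall>n::nat. smooth (w n) \<and> (\<exists>C. compact C \<and> C \<subseteq> D \<and> (\<forall>x. x \<notin> C \<longrightarrow> w n x = 0))"
    "(\<lambda>n. \<integral>\<^sup>+x. ennreal ((norm (v x - w n x))\<^sup>2) \<partial>lebesgue) \<longlonglongrightarrow> 0"
    "(\<lambda>n. \<integral>\<^sup>+x. ennreal ((norm (G x - grad (w n) x))\<^sup>2) \<partial>lebesgue) \<longlonglongrightarrow> 0"
    by (rule H10_E)
  have s1: "smooth (w n)" and c1: "\<exists>C. compact C \<and> C \<subseteq> D \<and> (\<forall>x. x \<notin> C \<longrightarrow> w n x = 0)" for n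
    using 1(3) by auto
  note [measurable] = 1(1)
  have [measurable]: "- D \<in> sets lebesgue" using D by auto
  let ?g = "\<lambda>x. ennreal (indicator (- D) x * (v x)\<^sup>2)"
  have "(\<integral>\<^sup>+x. ?g x \<partial>lebesgue) \<le> 0"
  proof (rule tendsto_lowerbound[OF 1(4)])
    show "\<forall>\<^sub>F n in sequentially. (\<integral>\<^sup>+x. ?g x \<partial>lebesgue) \<le>
        (\<integral>\<^sup>+x. ennreal ((norm (v x - w n x))\<^sup>2) \<partial>lebesgue)"
    proof (intro always_eventually allI nn_integral_mono ennreal_leI)
      fix n x
      have "w n x = 0" if "x \<notin> D" using c1[of n] that by auto
      then show "indicator (- D) x * (v x)\<^sup>2 \<le> (norm (v x - w n x))\<^sup>2"
        by (cases "x \<in> D") auto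
    qed
  qed simp
  then have "(\<integral>\<^sup>+x. ?g x \<partial>lebesgue) = 0" by simp
  then have "AE x in lebesgue. ?g x = 0"
    by (subst (asm) nn_integral_0_iff_AE) measurable
  then show ?thesis
    by eventually_elim (auto simp: indicator_def)
qed

subsection \<open>Galerkin solutions in a semi-inner product space\<close>

text \<open>Linearity is asked for on \<open>V\<close> only, since the integral of pointwise
  gradients is linear only where gradients exist almost everywhere and the products are integrable.
  Symmetry is unconditional because the integrand itself is symmetric.\<close>

locale semi_inner_product =
  fixes a :: "('a \<Rightarrow> real) \<Rightarrow> ('a \<Rightarrow> real) \<Rightarrow> real" and V :: "('a \<Rightarrow> real) set"
  assumes subspace: "fn.subspace V"
    and sym: "a v w = a w v"
    and add_right: "\<lbrakk>v \<in> V; w1 \<in> V; w2 \<in> V\<rbrakk> \<Longrightarrow> a v (w1 + w2) = a v w1 + a v w2"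
    and scale_right: "\<lbrakk>v \<in> V; w \<in> V\<rbrakk> \<Longrightarrow> a v (\<lambda>x. c * w x) = c * a v w"
    and nonneg: "v \<in> V \<Longrightarrow> 0 \<le> a v v"
begin

lemma mem_add: "\<lbrakk>v \<in> V; w \<in> V\<rbrakk> \<Longrightarrow> v + w \<in> V"
  using subspace by (simp add: fn.subspace_def)

lemma mem_scale: "v \<in> V \<Longrightarrow> (\<lambda>x. c * v x) \<in> V"
  using subspace by (simp add: fn.subspace_def)

lemma mem_diff: "\<lbrakk>v \<in> V; w \<in> V\<rbrakk> \<Longrightarrow> v - w \<in> V"
  using fn.subspace_diff[OF subspace] by simp

lemma mem_sum: "(\<And>i. i \<in> I \<Longrightarrow> \<phi> i \<in> V) \<Longrightarrow> sum \<phi> I \<in> V"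
  by (rule fn.subspace_sum[OF subspace])

lemma add_left: "\<lbrakk>v1 \<in> V; v2 \<in> V; w \<in> V\<rbrakk> \<Longrightarrow> a (v1 + v2) w = a v1 w + a v2 w"
  by (metis sym add_right)

lemma diff_right:
  assumes "v \<in> V" "w1 \<in> V" "w2 \<in> V"
  shows "a v (w1 - w2) = a v w1 - a v w2"
  using add_right[OF assms(1) mem_diff[OF assms(2,3)] assms(3)] by simp

lemma diff_left: "\<lbrakk>v1 \<in> V; v2 \<in> V; w \<in> V\<rbrakk> \<Longrightarrow> a (v1 - v2) w = a v1 w - a v2 w"
  by (metis sym diff_right)

lemma zero_right: "v \<in> V \<Longrightarrow> a v 0 = 0"
  using diff_right[of v v v] by simp

lemma sum_right:
  assumes "v \<in> V" "finite I" "\<And>i. i \<in> I \<Longrightarrow> \<phi> i \<in> V"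
  shows "a v (sum \<phi> I) = (\<Sum>i\<in>I. a v (\<phi> i))"
  using assms(2,3)
proof (induction I rule: finite_induct)
  case empty
  show ?case using zero_right[OF assms(1)] by (simp add: zero_fun_def)
next
  case (insert i I)
  have "a v (sum \<phi> (insert i I)) = a v (\<phi> i + sum \<phi> I)"
    by (rule arg_cong[of _ _ "a v"], rule sum.insert) (rule insert.hyps)+
  also have "\<dots> = a v (\<phi> i) + a v (sum \<phi> I)"
    using insert.prems by (intro add_right assms(1) mem_sum) auto
  also have "\<dots> = (\<Sum>j\<in>insert i I. a v (\<phi> j))" using insert by simp
  finally show ?case .
qed

lemma energy_norm_nonneg: "v \<in> V \<Longrightarrow> 0 \<le> energy_norm a v"
  by (simp add: energy_norm_def nonneg)

lemma energy_norm_square: "v \<in> V \<Longrightarrow> (energy_norm a v)\<^sup>2 = a v v"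
  by (simp add: energy_norm_def nonneg)

text \<open>The discriminant argument for the squared norm of \<open>v\<close> minus a multiple of
  \<open>w\<close>. Since the form is only semidefinite, a vector \<open>w\<close> of zero energy
  gets its own case.\<close>

lemma Cauchy_Schwarz:
  assumes v: "v \<in> V" and w: "w \<in> V"
  shows "\<bar>a v w\<bar> \<le> energy_norm a v * energy_norm a w"
proof -
  have quad: "0 \<le> a v v - 2 * t * a v w + t\<^sup>2 * a w w" for t
  proof -
    let ?tw = "\<lambda>x. t * w x"
    have tw: "?tw \<in> V" by (rule mem_scale[OF w])
    have "0 \<le> a (v - ?tw) (v - ?tw)" by (intro nonneg mem_diff v tw)
    also have "\<dots> = a v v - a v ?tw - (a ?tw v - a ?tw ?tw)"
      using v tw by (simp add: diff_right diff_left mem_diff)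
    also have "a ?tw v = t * a v w" by (metis sym scale_right[OF v w])
    also have "a v ?tw = t * a v w" by (rule scale_right[OF v w])
    also have "a ?tw ?tw = t * (t * a w w)"
      using scale_right[OF tw w, of t] scale_right[OF w w, of t] sym[of w ?tw] by simp
    finally show ?thesis by (simp add: power2_eq_square algebra_simps)
  qed
  have "(a v w)\<^sup>2 \<le> a v v * a w w"
  proof (cases "a w w = 0")
    case True
    have "a v w = 0"
    proof (rule ccontr)
      assume "a v w \<noteq> 0"
      then show False
        \<comment> \<open>With \<open>a w w = 0\<close> the quadratic is affine in its parameter,
          and this value makes it equal to -1.\<close>
        using quad[of "(a v v + 1) / (2 * a v w)"] True by (simp add: field_simps)
    qed
    then show ?thesis using True by simp
  next
    case False
    then have "0 < a w w" using nonneg[OF w] by simp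
    then show ?thesis
      \<comment> \<open>The parameter is the minimiser of the quadratic.\<close>
      using quad[of "a v w / a w w"] by (simp add: field_simps power2_eq_square)
  qed
  then have "sqrt ((a v w)\<^sup>2) \<le> sqrt (a v v * a w w)" by (rule real_sqrt_le_mono)
  then show ?thesis by (simp add: energy_norm_def real_sqrt_mult)
qed

text \<open>If \<open>energy_norm a v = 0\<close>, the quotient in \<^const>\<open>dual_norm\<close> has the value 0.\<close>

lemma dual_norm_bounds:
  assumes W: "W \<subseteq> V" and \<phi>: "galerkin_solution a W R \<phi>"
  shows "0 \<le> dual_norm a W R" and "dual_norm a W R \<le> energy_norm a \<phi>"
proof -
  let ?S = "insert 0 {\<bar>R v\<bar> / energy_norm a v | v. v \<in> W \<and> v \<noteq> 0}"
  have \<phi>V: "\<phi> \<in> V" and rep: "\<And>v. v \<in> W \<Longrightarrow> R v = a \<phi> v"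
    using \<phi> W by (auto simp: galerkin_solution_def)
  \<comment> \<open>This bound is used twice: as an upper bound of the supremum, and as the
    boundedness that a real \<open>Sup\<close> needs before it can be compared with its member
    0.\<close>
  have ub: "s \<le> energy_norm a \<phi>" if "s \<in> ?S" for s
  proof -
    have "\<bar>R v\<bar> / energy_norm a v \<le> energy_norm a \<phi>" if "v \<in> W" for v
    proof -
      have "v \<in> V" using that W by auto
      then show ?thesis
        using Cauchy_Schwarz[OF \<phi>V \<open>v \<in> V\<close>] energy_norm_nonneg[OF \<open>v \<in> V\<close>]
          energy_norm_nonneg[OF \<phi>V] rep[OF that]
        by (cases "energy_norm a v = 0") (auto simp: divide_simps)
    qed
    then show ?thesis using that energy_norm_nonneg[OF \<phi>V] by auto
  qed
  show "dual_norm a W R \<le> energy_norm a \<phi>"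
    unfolding dual_norm_def by (rule cSup_least) (use ub in auto)
  have "bdd_above ?S" using ub by (rule bdd_aboveI)
  then show "0 \<le> dual_norm a W R"
    unfolding dual_norm_def by (intro cSup_upper) auto
qed

section \<open>Galerkin projections and their enrichment\<close>

lemma galerkin_orthogonality:
  assumes "galerkin_solution a V lf y" "galerkin_solution a W lf yW" "W \<subseteq> V" "w \<in> W"
  shows "a (y - yW) w = 0"
  using assms by (auto simp: galerkin_solution_def diff_left subset_iff)

text \<open>Pythagoras: \<open>y - w\<close> splits into the error and the element
  \<open>yW - w\<close> of \<open>W\<close>, which are orthogonal.\<close>

lemma galerkin_best_approximation:
  assumes y: "galerkin_solution a V lf y" and yW: "galerkin_solution a W lf yW"
    and W: "fn.subspace W" "W \<subseteq> V" and w: "w \<in> W"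
  shows "energy_norm a (y - yW) \<le> energy_norm a (y - w)"
proof -
  have inV: "y \<in> V" "yW \<in> V" "w \<in> V" and "yW \<in> W"
    using y yW W w by (auto simp: galerkin_solution_def)
  let ?e = "y - yW" and ?d = "yW - w"
  have "?d \<in> W" using fn.subspace_diff[OF W(1) \<open>yW \<in> W\<close> w] by simp
  then have orth: "a ?e ?d = 0" by (rule galerkin_orthogonality[OF y yW W(2)])
  have e: "?e \<in> V" and d: "?d \<in> V" using inV by (auto intro: mem_diff)
  have "y - w = ?e + ?d" by simp
  then have "a (y - w) (y - w) = a ?e ?e + a ?e ?d + (a ?d ?e + a ?d ?d)"
    using add_left[OF e d mem_add[OF e d]] add_right[OF e e d] add_right[OF d e d] by metis
  also have "\<dots> = a ?e ?e + a ?d ?d" using orth sym[of ?d ?e] by simp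
  finally show ?thesis using nonneg[OF d] by (simp add: energy_norm_def)
qed

text \<open>The competitor \<open>yW + (\<Sum>i\<in>I. \<phi> i)\<close> in the best approximation property of \<open>yW'\<close>
  reduces the squared error by exactly the sum of the squared energy norms of the \<open>\<phi> i\<close>.\<close>

lemma galerkin_enrichment:
  assumes y: "galerkin_solution a V lf y"
    and yW: "galerkin_solution a W lf yW" and W: "W \<subseteq> V"
    and yW': "galerkin_solution a W' lf yW'" and W': "fn.subspace W'" "W' \<subseteq> V" "W \<subseteq> W'"
    and I: "finite I" and \<phi>W': "\<And>i. i \<in> I \<Longrightarrow> \<phi> i \<in> W'"
    and Vloc: "\<And>i. i \<in> I \<Longrightarrow> Vloc i \<subseteq> V"
    and \<phi>: "\<And>i. i \<in> I \<Longrightarrow> galerkin_solution a (Vloc i) (\<lambda>v. lf v - a yW v) (\<phi> i)"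
    and orth: "\<And>i j. \<lbrakk>i \<in> I; j \<in> I; i \<noteq> j\<rbrakk> \<Longrightarrow> a (\<phi> i) (\<phi> j) = 0"
  shows "(energy_norm a (y - yW'))\<^sup>2 \<le>
    (energy_norm a (y - yW))\<^sup>2 -
      (\<Sum>i\<in>I. (dual_norm a (Vloc i) (\<lambda>v. lf v - a yW v))\<^sup>2)"
proof -
  have inV: "y \<in> V" "yW \<in> V" "yW' \<in> V" and "yW \<in> W'"
    using y yW yW' W W' by (auto simp: galerkin_solution_def)
  have \<phi>V: "\<phi> i \<in> V" if "i \<in> I" for i using \<phi>W'[OF that] W' by auto
  define s where "s = sum \<phi> I"
  have s: "s \<in> V" unfolding s_def by (rule mem_sum) (rule \<phi>V)
  have e: "y - yW \<in> V" using inV by (intro mem_diff)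
  have sum_s: "a w s = (\<Sum>i\<in>I. a w (\<phi> i))" if "w \<in> V" for w
    unfolding s_def by (rule sum_right[OF that I \<phi>V])
  have "s \<in> W'" unfolding s_def by (rule fn.subspace_sum[OF W'(1)]) (rule \<phi>W')
  then have "yW + s \<in> W'"
    using fn.subspace_add[OF W'(1) \<open>yW \<in> W'\<close>] by simp
  then have "energy_norm a (y - yW') \<le> energy_norm a (y - (yW + s))"
    by (rule galerkin_best_approximation[OF y yW' W'(1,2)])
  moreover have "0 \<le> energy_norm a (y - yW')"
    using inV by (intro energy_norm_nonneg mem_diff)
  ultimately have "(energy_norm a (y - yW'))\<^sup>2 \<le> (energy_norm a (y - (yW + s)))\<^sup>2"
    by (intro power_mono)
  also have "\<dots> = a ((y - yW) - s) ((y - yW) - s)"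
    using e s by (simp add: energy_norm_square mem_diff flip: diff_diff_eq)
  also have "\<dots> = a (y - yW) (y - yW) - 2 * a (y - yW) s + a s s"
    using e s sym[of s "y - yW"] by (simp add: diff_left[OF e s mem_diff[OF e s]]
        diff_right[OF e e s] diff_right[OF s e s])
  \<comment> \<open>The error tested with \<open>\<phi> i\<close> is the residual at
    \<open>\<phi> i\<close>, and the defining equation of \<open>\<phi> i\<close>, tested with
    itself, turns this into its own energy. The cross term is thus twice the gain, of which the
    square of \<open>s\<close> gives one half back.\<close>
  also have "a (y - yW) s = (\<Sum>i\<in>I. a (\<phi> i) (\<phi> i))"
    unfolding sum_s[OF e]
  proof (rule sum.cong[OF refl])
    fix i assume i: "i \<in> I"
    have "a (y - yW) (\<phi> i) = lf (\<phi> i) - a yW (\<phi> i)"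
      using y \<phi>V[OF i] inV by (simp add: diff_left galerkin_solution_def)
    also have "\<dots> = a (\<phi> i) (\<phi> i)" using \<phi>[OF i] by (simp add: galerkin_solution_def)
    finally show "a (y - yW) (\<phi> i) = a (\<phi> i) (\<phi> i)" .
  qed
  also have "a s s = (\<Sum>i\<in>I. a (\<phi> i) (\<phi> i))"
    unfolding sum_s[OF s]
  proof (rule sum.cong[OF refl])
    fix i assume i: "i \<in> I"
    have "a s (\<phi> i) = (\<Sum>j\<in>I. a (\<phi> i) (\<phi> j))"
      by (simp add: sym[of s] sum_s \<phi>V i)
    also have "\<dots> = (\<Sum>j\<in>I. if j = i then a (\<phi> i) (\<phi> i) else 0)"
      using orth[OF i] by (intro sum.cong) auto
    also have "\<dots> = a (\<phi> i) (\<phi> i)" using I i by simp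
    finally show "a s (\<phi> i) = a (\<phi> i) (\<phi> i)" .
  qed
  also have "a (y - yW) (y - yW) - 2 * (\<Sum>i\<in>I. a (\<phi> i) (\<phi> i)) + (\<Sum>i\<in>I. a (\<phi> i) (\<phi> i))
      = (energy_norm a (y - yW))\<^sup>2 - (\<Sum>i\<in>I. (energy_norm a (\<phi> i))\<^sup>2)"
    using e \<phi>V by (simp add: energy_norm_square)
  \<comment> \<open>Each dual norm is at most the energy norm of its representative, so the
    subtracted sum only gets smaller.\<close>
  also have "\<dots> \<le> (energy_norm a (y - yW))\<^sup>2 -
      (\<Sum>i\<in>I. (dual_norm a (Vloc i) (\<lambda>v. lf v - a yW v))\<^sup>2)"
    by (intro diff_left_mono sum_mono power_mono dual_norm_bounds[OF Vloc \<phi>])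
  finally show ?thesis .
qed

lemma galerkin_contraction:
  assumes y: "galerkin_solution a V lf y"
    and yW: "galerkin_solution a W lf yW" and W: "W \<subseteq> V"
    and yW': "galerkin_solution a W' lf yW'" and W': "fn.subspace W'" "W' \<subseteq> V" "W \<subseteq> W'"
    and I: "finite J" "I \<subseteq> J" and \<phi>W': "\<And>i. i \<in> I \<Longrightarrow> \<phi> i \<in> W'"
    and Vloc: "\<And>i. i \<in> I \<Longrightarrow> Vloc i \<subseteq> V"
    and \<phi>: "\<And>i. i \<in> I \<Longrightarrow> galerkin_solution a (Vloc i) (\<lambda>v. lf v - a yW v) (\<phi> i)"
    and orth: "\<And>i j. \<lbrakk>i \<in> I; j \<in> I; i \<noteq> j\<rbrakk> \<Longrightarrow> a (\<phi> i) (\<phi> j) = 0"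
    and lam: "\<And>i. i \<in> J \<Longrightarrow> 0 < lam i" and "0 < C"
    and rho: "rho = (\<lambda>i. dual_norm a (Vloc i) (\<lambda>v. lf v - a yW v))"
    and bound: "(energy_norm a (y - yW))\<^sup>2 \<le> C * (\<Sum>i\<in>J. (rho i)\<^sup>2 * inverse (lam i))"
    and denom: "(\<Sum>i\<in>J. (rho i)\<^sup>2 * inverse (lam i)) \<noteq> 0"
    and onerp: "\<theta> \<le> Min (lam ` I) / C *
      ((\<Sum>i\<in>I. (rho i)\<^sup>2 * inverse (lam i)) / (\<Sum>i\<in>J. (rho i)\<^sup>2 * inverse (lam i)))"
    and "0 \<le> \<theta>"
  shows "(energy_norm a (y - yW'))\<^sup>2 \<le> (1 - \<theta>) * (energy_norm a (y - yW))\<^sup>2"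
proof -
  let ?D = "\<Sum>i\<in>J. (rho i)\<^sup>2 * inverse (lam i)"
  have finI: "finite I" using I by (rule rev_finite_subset)
  \<comment> \<open>Nonnegative and nonzero means positive, so the ONERP quotient can be multiplied
    out without reversing the inequality.\<close>
  have "0 \<le> ?D" using lam by (intro sum_nonneg) (simp add: less_imp_le)
  then have D: "0 < ?D" using denom by simp
  have "\<theta> * (energy_norm a (y - yW))\<^sup>2 \<le> \<theta> * (C * ?D)"
    using bound \<open>0 \<le> \<theta>\<close> by (rule mult_left_mono)
  also have "\<dots> \<le> Min (lam ` I) * (\<Sum>i\<in>I. (rho i)\<^sup>2 * inverse (lam i))"
    using onerp D \<open>0 < C\<close> by (simp add: field_simps)
  also have "\<dots> \<le> (\<Sum>i\<in>I. (rho i)\<^sup>2)"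
    unfolding sum_distrib_left
  proof (rule sum_mono)
    fix i assume i: "i \<in> I"
    then have "Min (lam ` I) \<le> lam i" and pos: "0 < lam i" using finI lam I by auto
    then have "Min (lam ` I) * ((rho i)\<^sup>2 * inverse (lam i)) \<le> lam i * ((rho i)\<^sup>2 * inverse (lam i))"
      by (intro mult_right_mono) auto
    then show "Min (lam ` I) * ((rho i)\<^sup>2 * inverse (lam i)) \<le> (rho i)\<^sup>2"
      using pos by (simp add: mult.left_commute[of "lam i"])
  qed
  finally have "\<theta> * (energy_norm a (y - yW))\<^sup>2 \<le> (\<Sum>i\<in>I. (rho i)\<^sup>2)" .
  moreover have "(energy_norm a (y - yW'))\<^sup>2 \<le> (energy_norm a (y - yW))\<^sup>2 - (\<Sum>i\<in>I. (rho i)\<^sup>2)"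
    unfolding rho
    by (rule galerkin_enrichment[OF y yW W yW' W' finI \<phi>W' Vloc \<phi> orth])
  ultimately show ?thesis by (simp add: algebra_simps)
qed

end

subsection \<open>Energy form and load functional on the finite element space\<close>

lemma affine_fun_on_add: "\<lbrakk>affine_fun_on T v; affine_fun_on T w\<rbrakk> \<Longrightarrow> affine_fun_on T (v + w)"
proof -
  assume "affine_fun_on T v" "affine_fun_on T w"
  then obtain p c q d where "\<forall>x\<in>T. v x = p \<bullet> x + c" "\<forall>x\<in>T. w x = q \<bullet> x + d"
    by (auto simp: affine_fun_on_def)
  then show ?thesis
    unfolding affine_fun_on_def
    by (intro exI[of _ "p + q"] exI[of _ "c + d"]) (simp add: inner_add_left)
qed

lemma affine_fun_on_scale: "affine_fun_on T v \<Longrightarrow> affine_fun_on T (\<lambda>x. k * v x)"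
proof -
  assume "affine_fun_on T v"
  then obtain p c where "\<forall>x\<in>T. v x = p \<bullet> x + c"
    by (auto simp: affine_fun_on_def)
  then show ?thesis
    unfolding affine_fun_on_def
    by (intro exI[of _ "k *\<^sub>R p"] exI[of _ "k * c"]) (simp add: distrib_left)
qed

lemma fe_space_subspace: "fn.subspace (fe_space \<T> D)"
proof -
  have "affine_fun_on T 0" for T :: "'a set"
    unfolding affine_fun_on_def by (intro exI[of _ 0]) simp
  then have "0 \<in> fe_space \<T> D"
    by (simp add: fe_space_def H10_zero)
  moreover have "v + w \<in> fe_space \<T> D" if "v \<in> fe_space \<T> D" "w \<in> fe_space \<T> D" for v w
  proof -
    have "continuous_on UNIV (v + w)"
      unfolding plus_fun_def using that by (intro continuous_on_add) (simp_all add: fe_space_def)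
    then show ?thesis using that by (simp add: fe_space_def H10_add affine_fun_on_add)
  qed
  moreover have "(\<lambda>x. c * v x) \<in> fe_space \<T> D" if "v \<in> fe_space \<T> D" for c v
    using that by (simp add: fe_space_def H10_scale affine_fun_on_scale continuous_on_mult_left)
  ultimately show ?thesis by (simp add: fn.subspace_def)
qed

lemma fe_space_affine:
  assumes "v \<in> fe_space \<T> D" "T \<in> \<T>"
  obtains p c where "\<And>y. y \<in> T \<Longrightarrow> v y = p \<bullet> y + c"
  using assms by (auto simp: fe_space_def affine_fun_on_def)

text \<open>What the computation on cells draws from the fine grid. Convexity makes each cell
  frontier a null set, and finiteness passes this on to their union.\<close>

locale fe_mesh =
  fixes \<T> :: "'a::euclidean_space set set" and \<Omega> :: "'a set"
  assumes finite: "finite \<T>"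
    and convex: "T \<in> \<T> \<Longrightarrow> convex T"
    and closed: "T \<in> \<T> \<Longrightarrow> closed T"
    and cover: "\<Omega> \<subseteq> \<Union>\<T>"
    and open_domain: "open \<Omega>"
    and bounded_domain: "bounded \<Omega>"
begin

text \<open>The exceptional null set: every other point of the domain is interior to a cell, where
  finite element functions are affine.\<close>

definition skeleton :: "'a set" where "skeleton = (\<Union>T\<in>\<T>. frontier T)"

lemma negligible_skeleton: "negligible skeleton"
  unfolding skeleton_def using finite convex
  by (intro negligible_Union) (auto intro: negligible_convex_frontier)

lemma interior_cover:
  assumes "x \<in> \<Omega> - skeleton"
  obtains T where "T \<in> \<T>" "x \<in> interior T"
  using assms cover closed by (force simp: skeleton_def frontier_def)

lemma domain_lmeasurable: "\<Omega> \<in> lmeasurable"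
  using open_domain bounded_domain by (rule lmeasurable_open[rotated])

lemma domain_sets [measurable]: "\<Omega> \<in> sets lebesgue"
  using domain_lmeasurable by (rule fmeasurableD)

lemma AE_domain:
  assumes "\<And>x. x \<in> \<Omega> - skeleton \<Longrightarrow> P x"
  shows "AE x in lebesgue_on \<Omega>. P x"
proof -
  have "AE x in lebesgue. x \<notin> skeleton"
    using negligible_skeleton by (intro AE_not_in) (simp add: negligible_iff_null_sets)
  then show ?thesis
    by (subst AE_restrict_space_iff) (use assms in auto)
qed

lemma differentiable:
  assumes "v \<in> fe_space \<T> \<Omega>" "x \<in> \<Omega> - skeleton"
  shows "v differentiable (at x)"
proof -
  obtain T where T: "T \<in> \<T>" "x \<in> interior T" using interior_cover[OF assms(2)] .
  obtain p c where "\<And>y. y \<in> T \<Longrightarrow> v y = p \<bullet> y + c" using fe_space_affine[OF assms(1) T(1)] by blast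
  with T(2) show ?thesis by (rule grad_affine)
qed

text \<open>On the skeleton the product of the gradients is uncontrolled. The function
  \<open>h\<close> replaces it by 0 outside all cell interiors, which makes it measurable and
  bounded everywhere.\<close>

lemma grad_inner_bounded:
  assumes v: "v \<in> fe_space \<T> \<Omega>" and w: "w \<in> fe_space \<T> \<Omega>"
  obtains h B where "h \<in> borel_measurable lebesgue" "\<And>x. \<bar>h x\<bar> \<le> B"
    "\<And>x. x \<in> \<Omega> - skeleton \<Longrightarrow> h x = grad v x \<bullet> grad w x"
proof -
  let ?U = "\<Union>T\<in>\<T>. interior T" and ?g = "\<lambda>x. grad v x \<bullet> grad w x"
  have const: "\<exists>c. \<forall>x\<in>interior T. ?g x = c" if T: "T \<in> \<T>" for T
  proof -
    obtain p c where p: "\<And>y. y \<in> T \<Longrightarrow> v y = p \<bullet> y + c" using fe_space_affine[OF v T] by blast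
    obtain q d where q: "\<And>y. y \<in> T \<Longrightarrow> w y = q \<bullet> y + d" using fe_space_affine[OF w T] by blast
    have "?g x = p \<bullet> q" if "x \<in> interior T" for x
      using grad_affine(2)[OF that p] grad_affine(2)[OF that q] by simp
    then show ?thesis by blast
  qed
  then obtain k where k: "\<And>T x. T \<in> \<T> \<Longrightarrow> x \<in> interior T \<Longrightarrow> ?g x = k T" by metis
  define h where "h = (\<lambda>x. if x \<in> ?U then ?g x else 0)"
  have "open ?U" by auto
  then have U: "?U \<in> sets lebesgue" using borel_open by auto
  show ?thesis
  proof
    \<comment> \<open>The product is constant on each cell interior, and continuity on a union of
      open sets can be checked on each of them.\<close>
    have "continuous_on ?U ?g"
    proof (rule continuous_on_open_UN)
      show "continuous_on (interior T) ?g" if "T \<in> \<T>" for T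
        using continuous_on_cong[of "interior T" "interior T" ?g "\<lambda>_. k T"] k[OF that] by auto
    qed simp
    then have "?g \<in> borel_measurable (lebesgue_on ?U)"
      using U by (rule continuous_imp_measurable_on_sets_lebesgue)
    then show "h \<in> borel_measurable lebesgue"
      unfolding h_def using U by (rule borel_measurable_if_I)
    \<comment> \<open>A sum instead of a maximum spares a case distinction on an empty mesh.\<close>
    show "\<bar>h x\<bar> \<le> (\<Sum>T\<in>\<T>. \<bar>k T\<bar>)" for x
    proof (cases "x \<in> ?U")
      case True
      then obtain T where T: "T \<in> \<T>" "x \<in> interior T" by auto
      then have "\<bar>h x\<bar> = \<bar>k T\<bar>" using k[OF T] True by (simp add: h_def)
      also have "\<dots> \<le> (\<Sum>T\<in>\<T>. \<bar>k T\<bar>)"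
        by (rule member_le_sum[OF T(1)]) (auto simp: finite)
      finally show ?thesis .
    next
      case False
      then show ?thesis by (simp add: h_def sum_nonneg)
    qed
    show "h x = ?g x" if x: "x \<in> \<Omega> - skeleton" for x
      using interior_cover[OF x] by (auto simp: h_def)
  qed
qed

text \<open>Linearity reduces to integrability of the products: \<open>v\<close> is bounded on the
  compact closure of the domain, and the absolute value of \<open>f\<close> is dominated by
  \<open>1 + (f x)\<^sup>2\<close>, integrable because the domain has finite measure. It makes the a
  posteriori bound applicable to the load functional.\<close>

lemma linear_functional_on_L2:
  assumes f: "f \<in> borel_measurable (lebesgue_on \<Omega>)" "integrable (lebesgue_on \<Omega>) (\<lambda>x. (f x)\<^sup>2)"
  shows "linear_functional_on (fe_space \<T> \<Omega>) (\<lambda>v. LINT x|lebesgue_on \<Omega>. f x * v x)"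
proof -
  interpret finite_measure "lebesgue_on \<Omega>"
    by (rule finite_measure_lebesgue_on) (rule domain_lmeasurable)
  have int: "integrable (lebesgue_on \<Omega>) (\<lambda>x. f x * v x)" if v: "v \<in> fe_space \<T> \<Omega>" for v
  proof -
    have cont: "continuous_on UNIV v" using v by (simp add: fe_space_def)
    then have "compact (v ` closure \<Omega>)"
      using bounded_domain by (intro compact_continuous_image) (auto intro: continuous_on_subset)
    then obtain B where B: "\<forall>x\<in>closure \<Omega>. \<bar>v x\<bar> \<le> B"
      using compact_imp_bounded bounded_iff by (metis imageI real_norm_def)
    have [measurable]: "v \<in> borel_measurable (lebesgue_on \<Omega>)"
      using continuous_borel_measurable_lebesgue[OF cont] by (rule measurable_restrict_space1)
    note [measurable] = f(1)
    have bound: "\<bar>f x * v x\<bar> \<le> (1 + (f x)\<^sup>2) * B" if "x \<in> \<Omega>" for x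
    proof -
      have "\<bar>v x\<bar> \<le> B" using B that closure_subset by blast
      moreover have "2 * \<bar>f x\<bar> \<le> 1 + (f x)\<^sup>2"
        using sum_squares_bound[of 1 "\<bar>f x\<bar>"] by simp
      then have "\<bar>f x\<bar> \<le> 1 + (f x)\<^sup>2" by linarith
      ultimately show ?thesis by (simp add: abs_mult mult_mono)
    qed
    show ?thesis
    proof (rule Bochner_Integration.integrable_bound)
      show "integrable (lebesgue_on \<Omega>) (\<lambda>x. (1 + (f x)\<^sup>2) * B)" using f(2) by simp
      show "AE x in lebesgue_on \<Omega>. norm (f x * v x) \<le> norm ((1 + (f x)\<^sup>2) * B)"
        using bound[THEN order_trans[OF _ abs_ge_self]] by (intro AE_I2) simp
    qed measurable
  qed
  show ?thesis
    unfolding linear_functional_on_def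
    using int by (auto simp: distrib_left mult.left_commute)
qed

end

section \<open>The weighted energy form and its locality\<close>

locale weighted_fe_mesh = fe_mesh +
  fixes \<kappa> :: "'a \<Rightarrow> real" and \<kappa>0 \<kappa>1 :: real
  assumes kappa_measurable: "\<kappa> \<in> borel_measurable (lebesgue_on \<Omega>)"
    and kappa_pos: "0 < \<kappa>0"
    and kappa_bounds: "AE x in lebesgue_on \<Omega>. \<kappa>0 \<le> \<kappa> x \<and> \<kappa> x \<le> \<kappa>1"
begin

lemma energy_integrable:
  assumes v: "v \<in> fe_space \<T> \<Omega>" and w: "w \<in> fe_space \<T> \<Omega>"
  shows "integrable (lebesgue_on \<Omega>) (\<lambda>x. \<kappa> x * (grad v x \<bullet> grad w x))"
proof -
  obtain h B where h: "h \<in> borel_measurable lebesgue" "\<And>x. \<bar>h x\<bar> \<le> B"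
    "\<And>x. x \<in> \<Omega> - skeleton \<Longrightarrow> h x = grad v x \<bullet> grad w x"
    using grad_inner_bounded[OF v w] by blast
  interpret finite_measure "lebesgue_on \<Omega>"
    by (rule finite_measure_lebesgue_on) (rule domain_lmeasurable)
  have [measurable]: "h \<in> borel_measurable (lebesgue_on \<Omega>)"
    using h(1) by (rule measurable_restrict_space1)
  note [measurable] = kappa_measurable
  have "integrable (lebesgue_on \<Omega>) (\<lambda>x. \<kappa> x * h x)"
  proof (rule integrable_const_bound[where B = "\<kappa>1 * B"])
    show "AE x in lebesgue_on \<Omega>. norm (\<kappa> x * h x) \<le> \<kappa>1 * B"
      using kappa_bounds
    proof eventually_elim
      case (elim x)
      then show ?case using h(2)[of x] kappa_pos by (auto simp: abs_mult intro!: mult_mono)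
    qed
  qed measurable
  \<comment> \<open>Absolute integrability on a set is stable under changes on a negligible set,
    which trades \<open>h\<close> for the true gradient product and yields the measurability of the
    latter as well.\<close>
  then have "(\<lambda>x. \<kappa> x * h x) absolutely_integrable_on \<Omega>"
    by (simp add: integrable_restrict_space set_integrable_def)
  then have "(\<lambda>x. \<kappa> x * (grad v x \<bullet> grad w x)) absolutely_integrable_on \<Omega>"
    by (rule absolutely_integrable_spike[OF _ negligible_skeleton]) (simp add: h(3))
  then show ?thesis by (simp add: integrable_restrict_space set_integrable_def)
qed

text \<open>Reduces identities of the energy form to points off the skeleton, where sum and scaling
  rules for \<open>grad\<close> are valid.\<close>

lemma energy_form_eqI:
  assumes "integrable (lebesgue_on \<Omega>) h" "v \<in> fe_space \<T> \<Omega>" "w \<in> fe_space \<T> \<Omega>"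
    and "\<And>x. x \<in> \<Omega> - skeleton \<Longrightarrow> \<kappa> x * (grad v x \<bullet> grad w x) = h x"
  shows "energy_form \<kappa> \<Omega> v w = integral\<^sup>L (lebesgue_on \<Omega>) h"
  unfolding energy_form_def
  using assms energy_integrable[OF assms(2,3)]
  by (intro integral_cong_AE AE_domain borel_measurable_integrable) auto

lemma semi_inner_product_energy_form:
  "semi_inner_product (energy_form \<kappa> \<Omega>) (fe_space \<T> \<Omega>)"
proof
  let ?a = "energy_form \<kappa> \<Omega>" and ?V = "fe_space \<T> \<Omega>"
  show sub: "fn.subspace ?V" by (rule fe_space_subspace)
  show "?a v w = ?a w v" for v w
    by (simp add: energy_form_def inner_commute)
  show "?a v (w1 + w2) = ?a v w1 + ?a v w2"
    if V: "v \<in> ?V" "w1 \<in> ?V" "w2 \<in> ?V" for v w1 w2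
  proof -
    note i = energy_integrable[OF V(1,2)] energy_integrable[OF V(1,3)]
    have "?a v (w1 + w2) = (LINT x|lebesgue_on \<Omega>.
        \<kappa> x * (grad v x \<bullet> grad w1 x) + \<kappa> x * (grad v x \<bullet> grad w2 x))"
    proof (rule energy_form_eqI)
      show "w1 + w2 \<in> ?V" using fn.subspace_add[OF sub V(2,3)] .
    qed (use V i in \<open>simp_all add: grad_add differentiable inner_add_right distrib_left\<close>)
    then show ?thesis using i by (simp add: energy_form_def)
  qed
  show "?a v (\<lambda>x. c * w x) = c * ?a v w" if V: "v \<in> ?V" "w \<in> ?V" for v w c
  proof -
    note i = energy_integrable[OF V]
    have "?a v (\<lambda>x. c * w x) = (LINT x|lebesgue_on \<Omega>. c * (\<kappa> x * (grad v x \<bullet> grad w x)))"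
    proof (rule energy_form_eqI)
      show "(\<lambda>x. c * w x) \<in> ?V" using fn.subspace_scale[OF sub V(2)] .
    qed (use V i in \<open>simp_all add: grad_scale differentiable\<close>)
    then show ?thesis by (simp add: energy_form_def)
  qed
  show "0 \<le> ?a v v" for v
    unfolding energy_form_def
  proof (rule integral_nonneg_AE)
    show "AE x in lebesgue_on \<Omega>. 0 \<le> \<kappa> x * (grad v x \<bullet> grad v x)"
      using kappa_bounds by eventually_elim (use kappa_pos in auto)
  qed
qed

text \<open>The product of the two functions is continuous and vanishes almost everywhere, hence
  everywhere; on each cell it is a product of two affine functions, so one of the factors vanishes
  identically there.\<close>

lemma energy_form_disjoint_supports:
  assumes v: "v \<in> fe_space \<T> \<Omega>" "v \<in> H10 D" "open D"
    and w: "w \<in> fe_space \<T> \<Omega>" "w \<in> H10 E" "open E"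
    and disj: "D \<inter> E = {}"
  shows "energy_form \<kappa> \<Omega> v w = 0"
proof -
  have "AE x in lebesgue. v x * w x = 0"
    using H10_vanishes_outside[OF v(2,3)] H10_vanishes_outside[OF w(2,3)]
    by eventually_elim (use disj in auto)
  then have "AE x in lebesgue. x \<notin> {x. v x * w x \<noteq> 0}" by simp
  moreover have "open {x. v x * w x \<noteq> 0}"
    using v(1) w(1) by (intro open_Collect_neq continuous_intros) (auto simp: fe_space_def)
  ultimately have "negligible {x. v x * w x \<noteq> 0}"
    by (simp add: negligible_iff_null_sets AE_iff_null_sets)
  with \<open>open {x. v x * w x \<noteq> 0}\<close> have "{x. v x * w x \<noteq> 0} = {}"
    using open_not_negligible by blast
  then have prod0: "v x * w x = 0" for x by blast
  have "\<kappa> x * (grad v x \<bullet> grad w x) = 0" if x: "x \<in> \<Omega> - skeleton" for x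
  proof -
    obtain T where T: "T \<in> \<T>" "x \<in> interior T" using interior_cover[OF x] .
    obtain p c where p: "\<And>y. y \<in> T \<Longrightarrow> v y = p \<bullet> y + c"
      using fe_space_affine[OF v(1) T(1)] by blast
    obtain q d where q: "\<And>y. y \<in> T \<Longrightarrow> w y = q \<bullet> y + d"
      using fe_space_affine[OF w(1) T(1)] by blast
    have grads: "grad v y = p" "grad w y = q" if "y \<in> interior T" for y
      using grad_affine(2)[OF that p] grad_affine(2)[OF that q] by auto
    \<comment> \<open>A nonzero gradient \<open>p\<close> forces \<open>v\<close> to be nonzero at
      some point \<open>y\<close> of the cell interior, hence near \<open>y\<close>. There
      \<open>w\<close> must vanish, and so does its gradient, which is \<open>q\<close> throughout
      the cell interior.\<close>
    have "q = 0" if "p \<noteq> 0"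
    proof -
      have "\<exists>y\<in>interior T. v y \<noteq> 0"
      proof (rule ccontr)
        assume "\<not> ?thesis"
        then have "\<And>y. y \<in> interior T \<Longrightarrow> v y = 0 \<bullet> y + 0" by simp
        moreover have "x \<in> interior (interior T)" using T(2) by (simp only: interior_interior)
        ultimately have "grad v x = 0" by (intro grad_affine(2))
        then show False using grads(1)[OF T(2)] that by simp
      qed
      then obtain y where y: "y \<in> interior T" "v y \<noteq> 0" by blast
      let ?N = "interior T \<inter> {y. v y \<noteq> 0}"
      have "open ?N"
        using v(1) by (intro open_Int open_Collect_neq continuous_intros) (auto simp: fe_space_def)
      then have "y \<in> interior ?N" using y interior_open by blast
      moreover have "\<And>y. y \<in> ?N \<Longrightarrow> w y = 0 \<bullet> y + 0" using prod0 by auto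
      ultimately have "grad w y = 0" by (rule grad_affine(2))
      then show "q = 0" using grads(2)[OF y(1)] by simp
    qed
    then show ?thesis using grads[OF T(2)] by (cases "p = 0") simp_all
  qed
  then have "energy_form \<kappa> \<Omega> v w = integral\<^sup>L (lebesgue_on \<Omega>) (\<lambda>_. 0)"
    by (intro energy_form_eqI v w) auto
  then show ?thesis by simp
qed

end

subsection \<open>Convergence of the goal-oriented enrichment\<close>

theorem theorem3p1:
  fixes \<Omega> :: "'a::euclidean_space set"
    and \<kappa> f :: "'a \<Rightarrow> real"
    and \<kappa>0 \<kappa>1 H C_err \<delta> \<theta>0 :: real
    and \<T>H \<T>h :: "'a set set"
    and Nc m :: nat
    and nd :: "nat \<Rightarrow> 'a"
    and \<omega> :: "nat \<Rightarrow> 'a set"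
    and a :: "('a \<Rightarrow> real) \<Rightarrow> ('a \<Rightarrow> real) \<Rightarrow> real"
    and F g :: "('a \<Rightarrow> real) \<Rightarrow> real"
    and V Voff :: "('a \<Rightarrow> real) set"
    and Vloc Vsnap :: "nat \<Rightarrow> ('a \<Rightarrow> real) set"
    and u z :: "'a \<Rightarrow> real"
    and \<eta> :: "nat \<Rightarrow> 'a \<Rightarrow> 'a \<Rightarrow> real"
    and chi :: "nat \<Rightarrow> 'a \<Rightarrow> real"
    and \<phi> :: "nat \<Rightarrow> nat \<Rightarrow> 'a \<Rightarrow> real"
    and lam :: "nat \<Rightarrow> nat \<Rightarrow> real"
    and L l :: "nat \<Rightarrow> nat"
    and Vms :: "nat \<Rightarrow> ('a \<Rightarrow> real) set"
    and ums zms :: "nat \<Rightarrow> 'a \<Rightarrow> real"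
    and \<phi>on \<psi>on :: "nat \<Rightarrow> nat \<Rightarrow> 'a \<Rightarrow> real"
    and Ru Rz :: "nat \<Rightarrow> nat \<Rightarrow> ('a \<Rightarrow> real) \<Rightarrow> real"
    and r rstar :: "nat \<Rightarrow> nat \<Rightarrow> real"
    and I_p I_d :: "nat \<Rightarrow> nat set"
    and \<Lambda>p \<Lambda>d :: "nat \<Rightarrow> real"
  \<comment> \<open>problem and grids\<close>
  assumes dim: "DIM('a) = 2 \<or> DIM('a) = 3"
    and domain: "open \<Omega>" "connected \<Omega>" "bounded \<Omega>"
    and kappa_bounds: "0 < \<kappa>0" "\<kappa>0 < \<kappa>1"
    and kappa: "\<kappa> \<in> borel_measurable (lebesgue_on \<Omega>)"
               "AE x in lebesgue_on \<Omega>. \<kappa>0 \<le> \<kappa> x \<and> \<kappa> x \<le> \<kappa>1"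
    and f: "f \<in> borel_measurable (lebesgue_on \<Omega>)"
           "integrable (lebesgue_on \<Omega>) (\<lambda>x. (f x)\<^sup>2)"
    and grids: "conforming_partition \<T>H \<Omega>" "simplicial_refinement \<T>h \<T>H"
    and H: "H = mesh_size \<T>H" "mesh_size \<T>h < H"
    and nd: "bij_betw nd {1..Nc} (nodes \<T>H \<inter> \<Omega>)"
    and \<omega>: "\<omega> = (\<lambda>i. neighborhood \<T>H (nd i))"
    and a: "a = energy_form \<kappa> \<Omega>"
    and F: "F = (\<lambda>v. LINT x|lebesgue_on \<Omega>. f x * v x)"
    and V: "V = fe_space \<T>h \<Omega>"
    and Vloc: "Vloc = (\<lambda>i. local_space V (\<omega> i))"
  \<comment> \<open>primal and dual problems\<close>
    and g: "linear_functional_on V g"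
    and u: "galerkin_solution a V F u"
    and z: "galerkin_solution a V g z"
  \<comment> \<open>offline space\<close>
    and L: "L = (\<lambda>i. card (boundary_nodes \<T>h (\<omega> i)))"
    and \<eta>: "\<And>i p. i \<in> {1..Nc} \<Longrightarrow> p \<in> boundary_nodes \<T>h (\<omega> i) \<Longrightarrow>
              is_snapshot \<T>h V \<kappa> (\<omega> i) p (\<eta> i p)"
    and Vsnap: "Vsnap = (\<lambda>i. fn.span (\<eta> i ` boundary_nodes \<T>h (\<omega> i)))"
    and chi: "ms_partition_of_unity \<T>H \<Omega> V \<kappa> Nc nd chi"
    and posdef: "\<And>i v. i \<in> {1..Nc} \<Longrightarrow> v \<in> Vsnap i \<Longrightarrow> v \<noteq> 0 \<Longrightarrow>
              0 < mass_form (kappa_tilde \<kappa> H Nc chi) (\<omega> i) v v"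
    and spectral: "\<And>i. i \<in> {1..Nc} \<Longrightarrow>
              spectral_system \<kappa> (kappa_tilde \<kappa> H Nc chi) (\<omega> i) (Vsnap i) (L i) (\<phi> i) (lam i)"
    and l: "\<And>i. i \<in> {1..Nc} \<Longrightarrow> 1 \<le> l i \<and> l i + 1 \<le> L i \<and> 0 < lam i (l i + 1)"
    and Voff: "Voff = fn.span (\<Union>i\<in>{1..Nc}. local_offline_space \<T>h V (chi i) (\<phi> i) (l i))"
  \<comment> \<open>the a posteriori constant\<close>
    and C_err: "0 < C_err"
               "a_posteriori_bound a V Voff Nc Vloc (\<lambda>i. lam i (l i + 1)) C_err"
  \<comment> \<open>online enrichment\<close>
    and Vms_0: "Vms 0 = Voff"
    and ums: "\<And>k. galerkin_solution a (Vms k) F (ums k)"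
    and zms: "\<And>k. galerkin_solution a (Vms k) g (zms k)"
    and Ru: "Ru = (\<lambda>k i v. F v - a (ums k) v)"
    and Rz: "Rz = (\<lambda>k i v. g v - a (zms k) v)"
    and r: "r = (\<lambda>k i. dual_norm a (Vloc i) (Ru k i))"
    and rstar: "rstar = (\<lambda>k i. dual_norm a (Vloc i) (Rz k i))"
    and \<phi>on: "\<And>k i. i \<in> {1..Nc} \<Longrightarrow> galerkin_solution a (Vloc i) (Ru k i) (\<phi>on k i)"
    and \<psi>on: "\<And>k i. i \<in> {1..Nc} \<Longrightarrow> galerkin_solution a (Vloc i) (Rz k i) (\<psi>on k i)"
    and I_p: "\<And>k. I_p k \<noteq> {} \<and> I_p k \<subseteq> {1..Nc}"
            "\<And>k i j. i \<in> I_p k \<Longrightarrow> j \<in> I_p k \<Longrightarrow> i \<noteq> j \<Longrightarrow> interior (\<omega> i) \<inter> interior (\<omega> j) = {}"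
    and I_d: "\<And>k. I_d k \<noteq> {} \<and> I_d k \<subseteq> {1..Nc}"
            "\<And>k i j. i \<in> I_d k \<Longrightarrow> j \<in> I_d k \<Longrightarrow> i \<noteq> j \<Longrightarrow> interior (\<omega> i) \<inter> interior (\<omega> j) = {}"
    and Vms_Suc: "\<And>k. Vms (Suc k) =
            {v + w | v w. v \<in> Vms k \<and> w \<in> fn.span (\<phi>on k ` I_p k \<union> \<psi>on k ` I_d k)}"
    and \<Lambda>p: "\<Lambda>p = (\<lambda>k. Min ((\<lambda>i. lam i (l i + 1)) ` I_p k))"
    and \<Lambda>d: "\<Lambda>d = (\<lambda>k. Min ((\<lambda>j. lam j (l j + 1)) ` I_d k))"
  \<comment> \<open>online error reduction property\<close>
    and \<theta>0: "0 < \<theta>0" "\<theta>0 < 1" "\<delta> < \<theta>0"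
    and denom: "\<And>k. k \<le> m \<Longrightarrow> (\<Sum>i=1..Nc. (r k i)\<^sup>2 * inverse (lam i (l i + 1))) \<noteq> 0"
               "\<And>k. k \<le> m \<Longrightarrow> (\<Sum>j=1..Nc. (rstar k j)\<^sup>2 * inverse (lam j (l j + 1))) \<noteq> 0"
    and ONERP_primal: "\<And>k. k \<le> m \<Longrightarrow>
            \<Lambda>p k / C_err *
              ((\<Sum>i\<in>I_p k. (r k i)\<^sup>2 * inverse (lam i (l i + 1))) /
               (\<Sum>i=1..Nc. (r k i)\<^sup>2 * inverse (lam i (l i + 1)))) \<ge> \<theta>0"
    and ONERP_dual: "\<And>k. k \<le> m \<Longrightarrow>
            \<Lambda>d k / C_err *
              ((\<Sum>j\<in>I_d k. (rstar k j)\<^sup>2 * inverse (lam j (l j + 1))) /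
               (\<Sum>j=1..Nc. (rstar k j)\<^sup>2 * inverse (lam j (l j + 1)))) \<ge> \<theta>0"
  shows "\<bar>g (u - ums (m + 1))\<bar>
           \<le> (1 - \<theta>0) * energy_norm a (u - ums m) * energy_norm a (z - zms m) \<and>
         (1 - \<theta>0) * energy_norm a (u - ums m) * energy_norm a (z - zms m)
           \<le> (1 - \<theta>0) ^ (m + 1) * energy_norm a (u - ums 0) * energy_norm a (z - zms 0)"
proof -
  have tri: "triangulation \<T>h" and simp_h: "\<And>T. T \<in> \<T>h \<Longrightarrow> int DIM('a) simplex T"
    and cover_h: "\<Union>\<T>h = closure \<Omega>"
    using grids by (auto simp: simplicial_refinement_def conforming_partition_def)
  interpret weighted_fe_mesh \<T>h \<Omega> \<kappa> \<kappa>0 \<kappa>1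
  proof
    show "finite \<T>h" using tri by (simp add: triangulation_def)
    show "\<And>T. T \<in> \<T>h \<Longrightarrow> convex T" using simp_h convex_simplex by blast
    show "\<And>T. T \<in> \<T>h \<Longrightarrow> closed T" using simp_h closed_simplex by blast
    show "\<Omega> \<subseteq> \<Union>\<T>h" using cover_h closure_subset by auto
  qed (use domain kappa kappa_bounds in auto)
  interpret semi_inner_product a V
    unfolding a V by (rule semi_inner_product_energy_form)
  have F_lin: "linear_functional_on V F"
    unfolding F V using f by (rule linear_functional_on_L2)
  have Vloc_V: "Vloc i \<subseteq> V" for i by (auto simp: Vloc local_space_def)
  have orth: "a v w = 0"
    if "v \<in> Vloc i" "w \<in> Vloc j" "interior (\<omega> i) \<inter> interior (\<omega> j) = {}" for v w i j
    using that unfolding a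
    by (intro energy_form_disjoint_supports[of _ "interior (\<omega> i)" _ "interior (\<omega> j)"])
      (auto simp: Vloc local_space_def V)
  have span_V: "fn.span S \<subseteq> V" if "S \<subseteq> V" for S
    using that by (rule fn.span_minimal[OF _ subspace])
  have local_off: "local_offline_space \<T>h V (chi i) (\<phi> i) (l i) \<subseteq> V" for i
    unfolding local_offline_space_def by (rule span_V) auto
  have on_Vloc: "\<phi>on k i \<in> Vloc i" "\<psi>on k i \<in> Vloc i" if "i \<in> {1..Nc}" for k i
    using \<phi>on[OF that, of k] \<psi>on[OF that, of k] unfolding galerkin_solution_def by blast+
  have on_V: "fn.span (\<phi>on k ` I_p k \<union> \<psi>on k ` I_d k) \<subseteq> V" for k
  proof (rule span_V)
    show "\<phi>on k ` I_p k \<union> \<psi>on k ` I_d k \<subseteq> V"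
      using on_Vloc I_p(1)[of k] I_d(1)[of k] Vloc_V by blast
  qed
  have Vms_mono: "Vms k \<subseteq> Vms (Suc k)" for k
  proof
    fix v assume "v \<in> Vms k"
    moreover have "v = v + 0" by simp
    ultimately show "v \<in> Vms (Suc k)" unfolding Vms_Suc using fn.span_zero by blast
  qed
  \<comment> \<open>The inclusion of \<open>Voff\<close> is carried along because the a posteriori
    bound is granted only for spaces containing the offline space.\<close>
  have Vms: "fn.subspace (Vms k) \<and> Vms k \<subseteq> V \<and> Voff \<subseteq> Vms k" for k
  proof (induction k)
    case 0
    have "Voff \<subseteq> V" unfolding Voff by (rule span_V) (use local_off in blast)
    moreover have "fn.subspace Voff" unfolding Voff by (rule fn.subspace_span)
    ultimately show ?case by (simp add: Vms_0)
  next
    case (Suc k)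
    have "fn.subspace (Vms (Suc k))"
      unfolding Vms_Suc using Suc by (intro fn.subspace_sums fn.subspace_span) simp
    moreover have "Vms (Suc k) \<subseteq> V"
      unfolding Vms_Suc using Suc on_V[of k] mem_add by blast
    ultimately show ?case using Suc Vms_mono[of k] by auto
  qed
  have new: "w \<in> Vms (Suc k)" if "w \<in> \<phi>on k ` I_p k \<union> \<psi>on k ` I_d k" for w k
  proof -
    have "0 \<in> Vms k" by (rule fn.subspace_0) (use Vms in blast)
    moreover have "w = 0 + w" by simp
    ultimately show ?thesis unfolding Vms_Suc using fn.span_base[OF that] by blast
  qed
  have apost: "(energy_norm a (y - yW))\<^sup>2 \<le>
      C_err * (\<Sum>i=1..Nc. (dual_norm a (Vloc i) (\<lambda>v. lf v - a yW v))\<^sup>2 * inverse (lam i (l i + 1)))"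
    if "linear_functional_on V lf" "galerkin_solution a V lf y" "galerkin_solution a (Vms k) lf yW"
    for lf y yW k
    using C_err(2) Vms[of k] that unfolding a_posteriori_bound_def by blast
  \<comment> \<open>The competitor uses the primal functions \<open>\<phi>on\<close> alone. The dual
    ones, whose supports may overlap theirs, merely enlarge the space in which the best
    approximation is taken.\<close>
  have primal: "(energy_norm a (u - ums (Suc k)))\<^sup>2 \<le> (1 - \<theta>0) * (energy_norm a (u - ums k))\<^sup>2"
    if k: "k \<le> m" for k
  proof (rule galerkin_contraction[where J = "{1..Nc}" and I = "I_p k" and \<phi> = "\<phi>on k"
        and Vloc = Vloc and lam = "\<lambda>i. lam i (l i + 1)" and C = C_err and rho = "r k"])
    show "galerkin_solution a V F u" "galerkin_solution a (Vms k) F (ums k)"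
      "galerkin_solution a (Vms (Suc k)) F (ums (Suc k))" by (fact u ums)+
    show "a (\<phi>on k i) (\<phi>on k j) = 0" if "i \<in> I_p k" "j \<in> I_p k" "i \<noteq> j" for i j
    proof (rule orth[OF _ _ I_p(2)[OF that]])
      show "\<phi>on k i \<in> Vloc i" "\<phi>on k j \<in> Vloc j"
        using on_Vloc(1) I_p(1) that by blast+
    qed
    show "r k = (\<lambda>i. dual_norm a (Vloc i) (\<lambda>v. F v - a (ums k) v))" by (simp add: r Ru)
    show "(energy_norm a (u - ums k))\<^sup>2 \<le>
        C_err * (\<Sum>i=1..Nc. (r k i)\<^sup>2 * inverse (lam i (l i + 1)))"
      unfolding r Ru by (rule apost[OF F_lin u ums])
    show "galerkin_solution a (Vloc i) (\<lambda>v. F v - a (ums k) v) (\<phi>on k i)" if "i \<in> I_p k" for i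
      using \<phi>on[of i k] I_p(1)[of k] that by (auto simp: Ru)
    show "\<theta>0 \<le> Min ((\<lambda>i. lam i (l i + 1)) ` I_p k) / C_err *
        ((\<Sum>i\<in>I_p k. (r k i)\<^sup>2 * inverse (lam i (l i + 1))) /
          (\<Sum>i=1..Nc. (r k i)\<^sup>2 * inverse (lam i (l i + 1))))"
      using ONERP_primal[OF k] by (simp only: \<Lambda>p)
    show "(\<Sum>i=1..Nc. (r k i)\<^sup>2 * inverse (lam i (l i + 1))) \<noteq> 0" by (rule denom(1)[OF k])
    show "\<And>i. i \<in> I_p k \<Longrightarrow> \<phi>on k i \<in> Vms (Suc k)" by (rule new) simp
    show "\<And>i. i \<in> {1..Nc} \<Longrightarrow> 0 < lam i (l i + 1)" using l by blast
    show "0 \<le> \<theta>0" using \<theta>0 by simp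
    show "Vloc i \<subseteq> V" for i by (rule Vloc_V)
    show "Vms k \<subseteq> Vms (Suc k)" by (rule Vms_mono)
  qed (use Vms I_p(1) C_err(1) in simp_all)
  have dual: "(energy_norm a (z - zms (Suc k)))\<^sup>2 \<le> (1 - \<theta>0) * (energy_norm a (z - zms k))\<^sup>2"
    if k: "k \<le> m" for k
  proof (rule galerkin_contraction[where J = "{1..Nc}" and I = "I_d k" and \<phi> = "\<psi>on k"
        and Vloc = Vloc and lam = "\<lambda>i. lam i (l i + 1)" and C = C_err and rho = "rstar k"])
    show "galerkin_solution a V g z" "galerkin_solution a (Vms k) g (zms k)"
      "galerkin_solution a (Vms (Suc k)) g (zms (Suc k))" by (fact z zms)+
    show "a (\<psi>on k i) (\<psi>on k j) = 0" if "i \<in> I_d k" "j \<in> I_d k" "i \<noteq> j" for i j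
    proof (rule orth[OF _ _ I_d(2)[OF that]])
      show "\<psi>on k i \<in> Vloc i" "\<psi>on k j \<in> Vloc j"
        using on_Vloc(2) I_d(1) that by blast+
    qed
    show "rstar k = (\<lambda>i. dual_norm a (Vloc i) (\<lambda>v. g v - a (zms k) v))" by (simp add: rstar Rz)
    show "(energy_norm a (z - zms k))\<^sup>2 \<le>
        C_err * (\<Sum>i=1..Nc. (rstar k i)\<^sup>2 * inverse (lam i (l i + 1)))"
      unfolding rstar Rz by (rule apost[OF g z zms])
    show "galerkin_solution a (Vloc i) (\<lambda>v. g v - a (zms k) v) (\<psi>on k i)" if "i \<in> I_d k" for i
      using \<psi>on[of i k] I_d(1)[of k] that by (auto simp: Rz)
    show "\<theta>0 \<le> Min ((\<lambda>i. lam i (l i + 1)) ` I_d k) / C_err *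
        ((\<Sum>i\<in>I_d k. (rstar k i)\<^sup>2 * inverse (lam i (l i + 1))) /
          (\<Sum>i=1..Nc. (rstar k i)\<^sup>2 * inverse (lam i (l i + 1))))"
      using ONERP_dual[OF k] by (simp only: \<Lambda>d)
    show "(\<Sum>i=1..Nc. (rstar k i)\<^sup>2 * inverse (lam i (l i + 1))) \<noteq> 0" by (rule denom(2)[OF k])
    show "\<And>i. i \<in> I_d k \<Longrightarrow> \<psi>on k i \<in> Vms (Suc k)" by (rule new) simp
    show "\<And>i. i \<in> {1..Nc} \<Longrightarrow> 0 < lam i (l i + 1)" using l by blast
    show "0 \<le> \<theta>0" using \<theta>0 by simp
    show "Vloc i \<subseteq> V" for i by (rule Vloc_V)
    show "Vms k \<subseteq> Vms (Suc k)" by (rule Vms_mono)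
  qed (use Vms I_d(1) C_err(1) in simp_all)
  define E where "E k = energy_norm a (u - ums k)" for k
  define Z where "Z k = energy_norm a (z - zms k)" for k
  have inV: "u \<in> V" "z \<in> V" "ums k \<in> V" "zms k \<in> V" for k
    using u z ums[of k] zms[of k] Vms[of k] by (auto simp: galerkin_solution_def)
  have nonneg: "0 \<le> E k" "0 \<le> Z k" for k
    unfolding E_def Z_def using inV by (auto intro!: energy_norm_nonneg mem_diff)
  \<comment> \<open>Multiplying the two squared contractions gives the square of
    \<open>1 - \<theta>0\<close>; comparing squares avoids handling the roots separately.\<close>
  have step: "E (Suc k) * Z (Suc k) \<le> (1 - \<theta>0) * (E k * Z k)" if k: "k \<le> m" for k
  proof (rule power2_le_imp_le)
    have "(E (Suc k))\<^sup>2 * (Z (Suc k))\<^sup>2 \<le> ((1 - \<theta>0) * (E k)\<^sup>2) * ((1 - \<theta>0) * (Z k)\<^sup>2)"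
      using primal[OF k] dual[OF k] \<theta>0 by (intro mult_mono) (auto simp: E_def Z_def)
    then show "(E (Suc k) * Z (Suc k))\<^sup>2 \<le> ((1 - \<theta>0) * (E k * Z k))\<^sup>2"
      by (simp add: power_mult_distrib power2_eq_square mult_ac)
    show "0 \<le> (1 - \<theta>0) * (E k * Z k)" using nonneg[of k] \<theta>0 by simp
  qed
  have iter: "E k * Z k \<le> (1 - \<theta>0) ^ k * (E 0 * Z 0)" if "k \<le> m" for k
    using that
  proof (induction k)
    case (Suc k)
    have "E (Suc k) * Z (Suc k) \<le> (1 - \<theta>0) * (E k * Z k)" using Suc by (intro step) simp
    also have "\<dots> \<le> (1 - \<theta>0) * ((1 - \<theta>0) ^ k * (E 0 * Z 0))"
      using Suc \<theta>0 by (intro mult_left_mono) auto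
    finally show ?case by simp
  qed simp
  let ?e = "u - ums (Suc m)" and ?d = "z - zms (Suc m)"
  \<comment> \<open>The dual problem is tested with the primal error. Subtracting the dual solution
    of the same level costs nothing, since it lies in the enriched space to which this error is
    orthogonal.\<close>
  have "g ?e = a z ?e" using z inV by (simp add: galerkin_solution_def mem_diff)
  also have "\<dots> = a ?d ?e + a ?e (zms (Suc m))"
    using inV sym[of ?e "zms (Suc m)"] by (simp add: diff_left mem_diff)
  also have "a ?e (zms (Suc m)) = 0"
    by (rule galerkin_orthogonality[OF u ums])
      (use Vms zms[of "Suc m"] in \<open>auto simp: galerkin_solution_def\<close>)
  finally have "g ?e = a ?d ?e" by (simp only: add_0_right)
  moreover have "\<bar>a ?d ?e\<bar> \<le> Z (Suc m) * E (Suc m)"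
    unfolding E_def Z_def by (intro Cauchy_Schwarz mem_diff inV)
  ultimately have "\<bar>g ?e\<bar> \<le> E (Suc m) * Z (Suc m)" by (metis mult.commute)
  also have "\<dots> \<le> (1 - \<theta>0) * (E m * Z m)" by (rule step) simp
  finally have first: "\<bar>g ?e\<bar> \<le> (1 - \<theta>0) * (E m * Z m)" .
  \<comment> \<open>The iteration reaches level \<open>m\<close> with exponent \<open>m\<close>; the
    factor already present in the middle term raises it to \<open>m + 1\<close>.\<close>
  have "(1 - \<theta>0) * (E m * Z m) \<le> (1 - \<theta>0) * ((1 - \<theta>0) ^ m * (E 0 * Z 0))"
    using iter[of m] \<theta>0 by (intro mult_left_mono) auto
  with first show ?thesis by (simp add: E_def Z_def mult.assoc)
qed

end
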